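(* Let $\mu$ be a centered probability measure on $\mathbb{Z}$. The Azéma–Yor stopping time $T^\mu_{AY}=\inf\{n\ge 0:\overline{X}_n\ge\Psi_\mu(X_n)\}$ embeds $\mu$ (i.e. it is a.s. finite and $X_{T^\mu_{AY}}\sim\mu$) if and only if $\Psi_\mu(x)\in\mathbb{N}$ for every $x\in\mathbb{Z}$. When this holds, $(X_{n\wedge T^\mu_{AY}}:n\ge0)$ is a uniformly integrable martingale.
   Context: $(X_n)_{n\ge 0}$ is the simple symmetric random walk on $\mathbb{Z}$: $X_0=0$ and $X_n=\sum_{k=1}^n\xi_k$ with $(\xi_k)$ i.i.d., $\mathbb{P}(\xi_k=1)=\mathbb{P}(\xi_k=-1)=\frac12$; $\overline{X}_n=\max_{k\le n}X_k$. Centered means $\sum_n|n|\mu(\{n\})<\infty$ and $\sum_n n\,\mu(\{n\})=0$. With $\overline{\mu}(x)=\mu([x,\infty))$, the barycenter (Hardy–Littlewood) function is $\Psi_\mu(x)=\frac{1}{\overline{\mu}(x)}\int_{[x,\infty)}y\,d\mu(y)$ if $\overline{\mu}(x)>0$, and $\Psi_\mu(x)=x$ if $\overline{\mu}(x)=0$. Here $\mathbb{N}=\{0,1,2,\dots\}$. *)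

theory Defs
  imports "HOL-Probability.Probability"
begin

section \<open>Uniformly integrable martingales in discrete time\<close>

definition natural_filtration :: "'a measure \<Rightarrow> (nat \<Rightarrow> 'a \<Rightarrow> int) \<Rightarrow> nat \<Rightarrow> 'a measure" where
  "natural_filtration M X n =
     sigma (space M) {X k -` A \<inter> space M | k A. k \<le> n}"

definition martingale :: "'a measure \<Rightarrow> (nat \<Rightarrow> 'a measure) \<Rightarrow> (nat \<Rightarrow> 'a \<Rightarrow> real) \<Rightarrow> bool" where
  "martingale M F Y \<longleftrightarrow>
     (\<forall>n. subalgebra M (F n)) \<and>
     (\<forall>m n. m \<le> n \<longrightarrow> sets (F m) \<subseteq> sets (F n)) \<and>
     (\<forall>n. Y n \<in> borel_measurable (F n)) \<and>
     (\<forall>n. integrable M (Y n)) \<and>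
     (\<forall>m n. m \<le> n \<longrightarrow> (AE \<omega> in M. real_cond_exp M (F m) (Y n) \<omega> = Y m \<omega>))"

text \<open>The supremum is taken in the extended nonnegative reals, so that it is meaningful
  even if it is infinite for small \<open>K\<close>.\<close>

definition uniformly_integrable :: "'a measure \<Rightarrow> 'i set \<Rightarrow> ('i \<Rightarrow> 'a \<Rightarrow> real) \<Rightarrow> bool" where
  "uniformly_integrable M I Y \<longleftrightarrow>
     (\<forall>i\<in>I. Y i \<in> borel_measurable M) \<and>
     ((\<lambda>K::real. SUP i\<in>I. \<integral>\<^sup>+\<omega>. ennreal \<bar>Y i \<omega>\<bar> * indicator {\<omega>. \<bar>Y i \<omega>\<bar> > K} \<omega> \<partial>M)
       \<longlongrightarrow> 0) at_top"

section \<open>The simple symmetric random walk\<close>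

text \<open>The increments are indexed by \<open>k \<ge> 1\<close>; the value \<open>\<xi> 0\<close> is irrelevant. Measurability
  of the increments is part of \<open>indep_vars\<close>.\<close>

locale simple_symmetric_steps = prob_space M
  for M :: "'a measure" and \<xi> :: "nat \<Rightarrow> 'a \<Rightarrow> int" +
  assumes indep_steps: "indep_vars (\<lambda>_. count_space UNIV) \<xi> {1..}"
    and prob_step_up: "\<And>k. k \<ge> 1 \<Longrightarrow> prob {\<omega> \<in> space M. \<xi> k \<omega> = 1} = 1 / 2"
    and prob_step_down: "\<And>k. k \<ge> 1 \<Longrightarrow> prob {\<omega> \<in> space M. \<xi> k \<omega> = - 1} = 1 / 2"

definition walk :: "(nat \<Rightarrow> 'a \<Rightarrow> int) \<Rightarrow> nat \<Rightarrow> 'a \<Rightarrow> int" where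
  "walk \<xi> n \<omega> = (\<Sum>k=1..n. \<xi> k \<omega>)"

definition running_max :: "(nat \<Rightarrow> 'a \<Rightarrow> int) \<Rightarrow> nat \<Rightarrow> 'a \<Rightarrow> int" where
  "running_max X n \<omega> = (MAX k\<in>{..n}. X k \<omega>)"

text \<open>The value of \<open>at_time X T\<close> on the event that \<open>T\<close> is infinite is a dummy; it does not
  affect \<open>embeds\<close>, which requires that event to be null.\<close>

definition at_time :: "(nat \<Rightarrow> 'a \<Rightarrow> int) \<Rightarrow> ('a \<Rightarrow> enat) \<Rightarrow> 'a \<Rightarrow> int" where
  "at_time X T \<omega> = X (the_enat (T \<omega>)) \<omega>"

definition stopped :: "(nat \<Rightarrow> 'a \<Rightarrow> int) \<Rightarrow> ('a \<Rightarrow> enat) \<Rightarrow> nat \<Rightarrow> 'a \<Rightarrow> int" where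
  "stopped X T n \<omega> = X (the_enat (min (enat n) (T \<omega>))) \<omega>"

definition embeds :: "'a measure \<Rightarrow> (nat \<Rightarrow> 'a \<Rightarrow> int) \<Rightarrow> ('a \<Rightarrow> enat) \<Rightarrow> int pmf \<Rightarrow> bool" where
  "embeds M X T \<mu> \<longleftrightarrow>
     (AE \<omega> in M. T \<omega> < \<infinity>) \<and>
     distr M (count_space UNIV) (at_time X T) = measure_pmf \<mu>"

section \<open>The barycenter function and the Azema--Yor stopping time\<close>

definition centered :: "int pmf \<Rightarrow> bool" where
  "centered \<mu> \<longleftrightarrow>
     (\<lambda>n. \<bar>real_of_int n\<bar> * pmf \<mu> n) summable_on UNIV \<and>
     (\<Sum>\<^sub>\<infinity>n. real_of_int n * pmf \<mu> n) = 0"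

definition tail :: "int pmf \<Rightarrow> int \<Rightarrow> real" where
  "tail \<mu> x = measure_pmf.prob \<mu> {x..}"

definition barycenter :: "int pmf \<Rightarrow> int \<Rightarrow> real" where
  "barycenter \<mu> x =
     (if tail \<mu> x > 0
      then (1 / tail \<mu> x) * (LINT y:{x..}|measure_pmf \<mu>. real_of_int y)
      else real_of_int x)"

text \<open>On \<^typ>\<open>enat\<close> the infimum of the empty set is \<open>\<infinity>\<close>.\<close>

definition azema_yor_time :: "int pmf \<Rightarrow> (nat \<Rightarrow> 'a \<Rightarrow> int) \<Rightarrow> 'a \<Rightarrow> enat" where
  "azema_yor_time \<mu> X \<omega> =
     Inf {enat n | n. real_of_int (running_max X n \<omega>) \<ge> barycenter \<mu> (X n \<omega>)}"

end

theory Submission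
  imports Defs
begin

text \<open>Write \<open>T\<close> for the Azema--Yor time, and let \<open>V m\<close> be the position of the walk stopped at
  \<open>T\<close> or on reaching level \<open>m\<close>, whichever comes first; this is the Azema--Yor time of
  \<open>min \<Psi> m\<close>. Either hypothesis provides a point \<open>a\<close> with \<open>\<Psi> a = 0\<close>, which bounds the stopped walk from
  below, so that \<open>V m\<close> has mean zero. As paths cannot jump over points, \<open>x \<le> W T\<close> holds exactly if
  the maximum at \<open>T\<close> is at least \<open>\<Psi> x\<close>.

  If \<open>T\<close> embeds \<open>\<mu>\<close>, comparing the mean of \<open>W T\<close> with that of \<open>V m\<close> for \<open>m = \<lceil>\<Psi> x\<rceil>\<close> shows that \<open>m\<close>
  is the barycenter at \<open>x\<close>. If \<open>\<Psi>\<close> is integer-valued, comparing the means for the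
  levels \<open>\<Psi> x\<close> and \<open>\<Psi> (x + 1)\<close> shows that the probability of reaching level \<open>\<Psi> x\<close> satisfies
  the same recursion in \<open>x\<close> as the tail of \<open>\<mu>\<close>; hence the two agree. The stopped walk is then
  bounded below and converges to \<open>W T\<close> with constant mean, so Scheffe's lemma gives convergence in
  \<open>L\<^sup>1\<close>, and therefore uniform integrability.\<close>

section \<open>The barycenter function of a centered measure\<close>

text \<open>The numerator of the barycenter. Unlike the quotient, it obeys its recursion in
  \<open>x\<close> with no case distinction on the tail.\<close>

definition tail_mean :: "int pmf \<Rightarrow> int \<Rightarrow> real" where
  "tail_mean \<mu> x = (LINT y:{x..}|measure_pmf \<mu>. real_of_int y)"

text \<open>\<open>centered\<close> speaks of sums over the atoms; viewing
  \<open>measure_pmf\<close> as a density with respect to counting measure turns absolute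
  summability into integrability.\<close>

lemma centered_integrable:
  assumes "centered \<mu>"
  shows "integrable (measure_pmf \<mu>) real_of_int"
proof -
  have s: "(\<lambda>n. \<bar>real_of_int n\<bar> * pmf \<mu> n) summable_on UNIV"
    using assms by (simp add: centered_def)
  have e: "\<bar>real_of_int n\<bar> * pmf \<mu> n = norm (pmf \<mu> n *\<^sub>R real_of_int n)" for n
    by (simp add: abs_mult)
  have "(\<lambda>n. norm (pmf \<mu> n *\<^sub>R real_of_int n)) summable_on UNIV"
    using s unfolding e .
  then have "Infinite_Set_Sum.abs_summable_on (\<lambda>n. pmf \<mu> n *\<^sub>R real_of_int n) UNIV"
    using abs_summable_equivalent by blast
  then have "integrable (density (count_space UNIV) (\<lambda>n. ennreal (pmf \<mu> n))) real_of_int"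
    unfolding Infinite_Set_Sum.abs_summable_on_def
    by (subst integrable_density) auto
  then show ?thesis by (simp add: measure_pmf_eq_density)
qed

lemma centered_expectation:
  assumes "centered \<mu>"
  shows "(\<integral>y. real_of_int y \<partial>measure_pmf \<mu>) = 0"
proof -
  have s: "(\<lambda>n. \<bar>real_of_int n\<bar> * pmf \<mu> n) summable_on UNIV"
    using assms by (simp add: centered_def)
  have e: "\<bar>real_of_int n\<bar> * pmf \<mu> n = norm (real_of_int n * pmf \<mu> n)" for n
    by (simp add: abs_mult)
  have "(\<lambda>n. norm (real_of_int n * pmf \<mu> n)) summable_on UNIV"
    using s unfolding e .
  then have a: "Infinite_Set_Sum.abs_summable_on (\<lambda>n. real_of_int n * pmf \<mu> n) UNIV"
    using abs_summable_equivalent by blast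
  have "(\<integral>y. real_of_int y \<partial>measure_pmf \<mu>) = infsetsum (\<lambda>n. pmf \<mu> n *\<^sub>R real_of_int n) UNIV"
    unfolding measure_pmf_eq_density infsetsum_def
    by (subst integral_density) auto
  also have "\<dots> = infsetsum (\<lambda>n. real_of_int n * pmf \<mu> n) UNIV"
    by (simp add: mult.commute)
  also have "\<dots> = (\<Sum>\<^sub>\<infinity>n. real_of_int n * pmf \<mu> n)"
    using infsetsum_infsum[OF a] .
  also have "\<dots> = 0" using assms by (simp add: centered_def)
  finally show ?thesis .
qed

section \<open>Tails and tail means\<close>

lemma tail_nonneg: "0 \<le> tail \<mu> x"
  by (simp add: tail_def)

lemma tail_eq_integral: "tail \<mu> x = (\<integral>y. indicator {x..} y \<partial>measure_pmf \<mu>)"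
  by (simp add: tail_def)

lemma tail_eq_Suc: "tail \<mu> x = pmf \<mu> x + tail \<mu> (x + 1)"
proof -
  have "{x..} = {x} \<union> {x+1..}" by auto
  moreover have "measure_pmf.prob \<mu> ({x} \<union> {x+1..}) = measure_pmf.prob \<mu> {x} + measure_pmf.prob \<mu> {x+1..}"
    by (rule measure_pmf.finite_measure_Union) auto
  ultimately show ?thesis by (simp add: tail_def measure_pmf_single)
qed

lemma tail_tendsto_0: "(\<lambda>n. tail \<mu> (int n)) \<longlonglongrightarrow> 0"
proof -
  have "(\<lambda>n. measure_pmf.prob \<mu> {int n..}) \<longlonglongrightarrow> measure_pmf.prob \<mu> (\<Inter>n. {int n..})"
    by (rule measure_pmf.finite_Lim_measure_decseq) (auto simp: decseq_def)
  also have "(\<Inter>n. {int n..}) = {}"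
  proof -
    have "x \<notin> (\<Inter>n. {int n..})" for x
    proof
      assume "x \<in> (\<Inter>n. {int n..})"
      then have "int (nat (x + 1)) \<le> x" by blast
      then show False by (cases "0 \<le> x + 1") auto
    qed
    then show ?thesis by blast
  qed
  finally show ?thesis by (simp add: tail_def)
qed

lemma integrable_pmf_indicator: "integrable (measure_pmf \<mu>) (indicator A :: int \<Rightarrow> real)"
  by (simp add: measure_pmf.emeasure_finite less_top[symmetric])

context
  fixes \<mu> :: "int pmf"
  assumes centered: "centered \<mu>"
begin

lemma integrable_pmf_indicator_mult: "integrable (measure_pmf \<mu>) (\<lambda>y. indicator A y * real_of_int y)"
  using integrable_mult_indicator[OF _ centered_integrable[OF centered], of A] by simp

lemma tail_mean_eq: "tail_mean \<mu> x = (\<integral>y. indicator {x..} y * real_of_int y \<partial>measure_pmf \<mu>)"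
  by (simp add: tail_mean_def set_lebesgue_integral_def)

lemma tail_mean_eq_Suc: "tail_mean \<mu> x = real_of_int x * pmf \<mu> x + tail_mean \<mu> (x + 1)"
proof -
  have "(\<lambda>y. indicator {x..} y * real_of_int y) =
        (\<lambda>y. real_of_int x * indicator {x} y + indicator {x+1..} y * real_of_int y)"
    by (auto simp: fun_eq_iff indicator_def)
  then have "tail_mean \<mu> x = (\<integral>y. real_of_int x * indicator {x} y + indicator {x+1..} y * real_of_int y \<partial>measure_pmf \<mu>)"
    by (simp add: tail_mean_eq)
  also have "\<dots> = real_of_int x * pmf \<mu> x + tail_mean \<mu> (x + 1)"
    using integrable_pmf_indicator_mult[of "{x+1..}"] integrable_pmf_indicator[of \<mu> "{x}"]
    by (subst Bochner_Integration.integral_add) (auto simp: tail_mean_eq measure_pmf_single)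
  finally show ?thesis .
qed

lemma tail_mean_ge: "real_of_int x * tail \<mu> x \<le> tail_mean \<mu> x"
proof -
  have "(\<integral>y. real_of_int x * indicator {x..} y \<partial>measure_pmf \<mu>) \<le> tail_mean \<mu> x"
    unfolding tail_mean_eq
    by (rule integral_mono)
       (auto simp: integrable_pmf_indicator_mult integrable_pmf_indicator split: split_indicator)
  then show ?thesis by (simp add: tail_def)
qed

text \<open>The total mean is zero. For \<open>x \<le> 0\<close> the integrand on the right is
  nonnegative, so the sign and the vanishing of the tail mean can be read off.\<close>

lemma tail_mean_complement: "tail_mean \<mu> x = (\<integral>y. indicator {..<x} y * (- real_of_int y) \<partial>measure_pmf \<mu>)"
proof -
  have "tail_mean \<mu> x + (\<integral>y. indicator {..<x} y * real_of_int y \<partial>measure_pmf \<mu>)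
     = (\<integral>y. indicator {x..} y * real_of_int y + indicator {..<x} y * real_of_int y \<partial>measure_pmf \<mu>)"
    unfolding tail_mean_eq by (simp add: integrable_pmf_indicator_mult)
  also have "(\<lambda>y. indicator {x..} y * real_of_int y + indicator {..<x} y * real_of_int y) = real_of_int"
    by (auto simp: fun_eq_iff indicator_def)
  finally show ?thesis using centered_expectation[OF centered] by simp
qed

text \<open>Where the tail vanishes, so does the tail mean, and the default value of the barycenter
  is multiplied by 0.\<close>

lemma tail_mean_eq_barycenter: "tail_mean \<mu> x = barycenter \<mu> x * tail \<mu> x"
proof (cases "tail \<mu> x = 0")
  case True
  then have "AE y in measure_pmf \<mu>. y \<notin> {x..}"
    by (simp add: tail_def measure_pmf.prob_eq_0)
  then have "AE y in measure_pmf \<mu>. indicator {x..} y * real_of_int y = 0"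
    by eventually_elim simp
  then have "tail_mean \<mu> x = 0"
    unfolding tail_mean_eq by (rule integral_eq_zero_AE)
  then show ?thesis using True by simp
next
  case False
  then have "tail \<mu> x > 0" using tail_nonneg[of \<mu> x] by linarith
  then show ?thesis unfolding barycenter_def tail_mean_def by simp
qed

section \<open>Bounds, monotonicity and zeros of the barycenter function\<close>

lemma le_barycenter: "real_of_int x \<le> barycenter \<mu> x"
proof (cases "tail \<mu> x > 0")
  case True
  with tail_mean_ge[of x] show ?thesis by (simp add: tail_mean_eq_barycenter)
qed (simp add: barycenter_def)

text \<open>With no mass beyond \<open>x\<close>, either the tail consists of the atom at
  \<open>x\<close>, or it is zero and the default value applies.\<close>

lemma barycenter_eq_self: 
  assumes "tail \<mu> (x + 1) = 0"
  shows "barycenter \<mu> x = real_of_int x"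
proof (cases "tail \<mu> x > 0")
  case True
  have "tail_mean \<mu> (x+1) = 0" using assms by (simp add: tail_mean_eq_barycenter)
  then have "barycenter \<mu> x * tail \<mu> x = real_of_int x * tail \<mu> x"
    using tail_mean_eq_Suc[of x] tail_eq_Suc[of \<mu> x] assms by (simp add: tail_mean_eq_barycenter)
  with True show ?thesis by simp
qed (simp add: barycenter_def)

text \<open>Subtracting \<open>x\<close> times the tail recursion from the tail mean recursion
  eliminates the atom at \<open>x\<close>. The probabilities of reaching the levels
  \<open>\<Psi> x\<close> satisfy the same recursion, see \<open>reached_recursion\<close>.\<close>

lemma barycenter_recursion:
  "tail \<mu> (x + 1) * (barycenter \<mu> (x + 1) - real_of_int x) = tail \<mu> x * (barycenter \<mu> x - real_of_int x)"
  using tail_mean_eq_Suc[of x] tail_eq_Suc[of \<mu> x]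
  by (simp add: tail_mean_eq_barycenter algebra_simps)

text \<open>Discarding the atom at \<open>x\<close>, which lies at or below the barycenter, can only
  move the barycenter up.\<close>

lemma mono_barycenter: "mono (barycenter \<mu>)"
proof -
  have step: "barycenter \<mu> x \<le> barycenter \<mu> (x + 1)" for x
  proof (cases "tail \<mu> (x + 1) = 0")
    case True
    then show ?thesis using barycenter_eq_self[OF True] le_barycenter[of "x+1"] by simp
  next
    case False
    then have p: "tail \<mu> (x + 1) > 0" using tail_nonneg[of \<mu> "x+1"] by linarith
    have "tail \<mu> (x + 1) * (barycenter \<mu> (x + 1) - barycenter \<mu> x) = pmf \<mu> x * (barycenter \<mu> x - real_of_int x)"
      using barycenter_recursion[of x] tail_eq_Suc[of \<mu> x] by (simp add: algebra_simps)
    also have "\<dots> \<ge> 0" using le_barycenter[of x] by simp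
    finally show ?thesis using p by (simp add: zero_le_mult_iff)
  qed
  show ?thesis
  proof
    fix x y :: int assume "x \<le> y"
    then show "barycenter \<mu> x \<le> barycenter \<mu> y"
      by (induction rule: int_ge_induct) (auto intro: order_trans step)
  qed
qed

lemma barycenter_eq_0_if_tail_1:
  assumes "tail \<mu> a = 1"
  shows "barycenter \<mu> a = 0"
proof -
  have "AE y in measure_pmf \<mu>. y \<in> {a..}"
    using assms by (simp add: tail_def measure_pmf.prob_eq_1)
  then have "AE y in measure_pmf \<mu>. indicator {..<a} y * (- real_of_int y) = 0"
    by eventually_elim (simp add: indicator_def)
  then have "tail_mean \<mu> a = 0"
    unfolding tail_mean_complement by (rule integral_eq_zero_AE)
  then show ?thesis using assms by (simp add: tail_mean_eq_barycenter)
qed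

text \<open>For \<open>a \<le> 0\<close> the integrand in \<open>tail_mean_complement\<close> is
  positive below \<open>a\<close>, so a zero integral leaves no mass there.\<close>

lemma tail_1_if_tail_mean_0:
  assumes "tail_mean \<mu> a = 0" "a \<le> 0"
  shows "tail \<mu> a = 1"
proof -
  have i: "integrable (measure_pmf \<mu>) (\<lambda>y. indicator {..<a} y * (- real_of_int y))"
    using integrable_pmf_indicator_mult[of "{..<a}"] by simp
  have "AE y in measure_pmf \<mu>. indicator {..<a} y * (- real_of_int y) = 0"
    using assms(1) unfolding tail_mean_complement
    by (subst (asm) integral_nonneg_eq_0_iff_AE[OF i])
       (use assms(2) in \<open>auto simp: indicator_def\<close>)
  then have "AE y in measure_pmf \<mu>. y \<in> {a..}"
    by eventually_elim (use assms(2) in \<open>auto simp: indicator_def split: if_splits\<close>)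
  then show ?thesis by (simp add: tail_def measure_pmf.prob_eq_1)
qed

lemma barycenter_nonneg: "0 \<le> barycenter \<mu> x"
proof (cases "0 \<le> x")
  case True
  then show ?thesis using le_barycenter[of x] by linarith
next
  case False
  have t: "tail_mean \<mu> x \<ge> 0"
    unfolding tail_mean_complement
    by (rule integral_nonneg_AE) (use False in \<open>auto simp: indicator_def\<close>)
  \<comment> \<open>A zero tail would have zero tail mean, which by
    \<open>tail_1_if_tail_mean_0\<close> forces the tail to be 1.\<close>
  have "tail \<mu> x \<noteq> 0"
    using tail_1_if_tail_mean_0[of x] False by (auto simp: tail_mean_eq_barycenter)
  then have "tail \<mu> x > 0" using tail_nonneg[of \<mu> x] by linarith
  then show ?thesis using t by (simp add: tail_mean_eq_barycenter zero_le_mult_iff)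
qed

lemma tail_1_if_barycenter_0: "barycenter \<mu> a = 0 \<Longrightarrow> tail \<mu> a = 1"
  using tail_1_if_tail_mean_0[of a] le_barycenter[of a] by (simp add: tail_mean_eq_barycenter)

text \<open>Towards minus infinity the tail mean tends to the mean 0 and the tail to 1, so their
  quotient falls below 1. Where the barycenter is a natural number, this bound makes it 0.\<close>

lemma barycenter_less_1: "\<exists>c. barycenter \<mu> c < 1"
proof -
  let ?s = "\<lambda>n y. indicator {- int n..} y :: real"
  have ev: "eventually (\<lambda>n. ?s n y = 1) sequentially" for y :: int
    using eventually_ge_at_top[of "nat (- y)"] by eventually_elim (auto simp: indicator_def)
  have "(\<lambda>n. \<integral>y. ?s n y * real_of_int y \<partial>measure_pmf \<mu>) \<longlonglongrightarrow> (\<integral>y. real_of_int y \<partial>measure_pmf \<mu>)"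
  proof (rule integral_dominated_convergence[where w = "\<lambda>y. \<bar>real_of_int y\<bar>"])
    show "AE y in measure_pmf \<mu>. (\<lambda>n. ?s n y * real_of_int y) \<longlonglongrightarrow> real_of_int y"
    proof (rule AE_I2)
      fix y
      show "(\<lambda>n. ?s n y * real_of_int y) \<longlonglongrightarrow> real_of_int y"
        using ev[of y] by (intro tendsto_eventually) (auto elim: eventually_mono)
    qed
    show "AE y in measure_pmf \<mu>. norm (?s n y * real_of_int y) \<le> \<bar>real_of_int y\<bar>" for n
      by (rule AE_I2) (auto simp: indicator_def)
  qed (use centered_integrable[OF centered] in auto)
  then have m: "(\<lambda>n. tail_mean \<mu> (- int n)) \<longlonglongrightarrow> 0"
    using centered_expectation[OF centered] by (simp add: tail_mean_eq)
  have "(\<lambda>n. \<integral>y. ?s n y \<partial>measure_pmf \<mu>) \<longlonglongrightarrow> (\<integral>y. 1 \<partial>measure_pmf \<mu>)"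
  proof (rule integral_dominated_convergence[where w = "\<lambda>y. 1"])
    show "AE y in measure_pmf \<mu>. (\<lambda>n. ?s n y) \<longlonglongrightarrow> 1"
      by (rule AE_I2, rule tendsto_eventually, rule ev)
    show "AE y in measure_pmf \<mu>. norm (?s n y) \<le> 1" for n
      by (rule AE_I2) (auto simp: indicator_def)
  qed auto
  then have t: "(\<lambda>n. tail \<mu> (- int n)) \<longlonglongrightarrow> 1"
    by (simp add: tail_eq_integral del: Bochner_Integration.integral_indicator)
  have "eventually (\<lambda>n. tail_mean \<mu> (- int n) < tail \<mu> (- int n) \<and> tail \<mu> (- int n) > 0) sequentially"
  proof -
    have "eventually (\<lambda>n. tail_mean \<mu> (- int n) < 1/2) sequentially"
      using order_tendstoD(2)[OF m, of "1/2"] by simp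
    moreover have "eventually (\<lambda>n. 1/2 < tail \<mu> (- int n)) sequentially"
      using order_tendstoD(1)[OF t, of "1/2"] by simp
    ultimately show ?thesis by eventually_elim linarith
  qed
  then obtain n where "tail_mean \<mu> (- int n) < tail \<mu> (- int n)" "tail \<mu> (- int n) > 0"
    using eventually_happens trivial_limit_sequentially by blast
  then show ?thesis
    by (intro exI[of _ "- int n"]) (simp add: tail_mean_eq_barycenter)
qed

end

section \<open>Nearest-neighbour paths\<close>

definition first_time :: "(nat \<Rightarrow> 'a \<Rightarrow> bool) \<Rightarrow> 'a \<Rightarrow> enat" where
  "first_time P \<omega> = Inf {enat n | n. P n \<omega>}"

lemma first_time_le_iff: "first_time P \<omega> \<le> enat n \<longleftrightarrow> (\<exists>k\<le>n. P k \<omega>)"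
proof
  assume le: "first_time P \<omega> \<le> enat n"
  then have "{enat n | n. P n \<omega>} \<noteq> {}"
    by (auto simp: first_time_def Inf_enat_def split: if_splits)
  then have "first_time P \<omega> \<in> {enat n | n. P n \<omega>}"
    unfolding first_time_def Inf_enat_def by (metis (mono_tags, lifting) LeastI_ex ex_in_conv)
  then show "\<exists>k\<le>n. P k \<omega>" using le by auto
next
  assume "\<exists>k\<le>n. P k \<omega>"
  then obtain k where "k \<le> n" "P k \<omega>" by blast
  then have "first_time P \<omega> \<le> enat k" unfolding first_time_def by (intro Inf_lower) auto
  also have "enat k \<le> enat n" using \<open>k \<le> n\<close> by simp
  finally show "first_time P \<omega> \<le> enat n" .
qed

lemma less_first_time_iff: "enat n < first_time P \<omega> \<longleftrightarrow> (\<forall>k\<le>n. \<not> P k \<omega>)"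
  using first_time_le_iff[of P \<omega> n] by (auto simp: not_le[symmetric])

lemma first_time_eq_iff: "first_time P \<omega> = enat n \<longleftrightarrow> P n \<omega> \<and> (\<forall>k<n. \<not> P k \<omega>)"
proof -
  have "first_time P \<omega> = enat n \<longleftrightarrow> first_time P \<omega> \<le> enat n \<and> (\<forall>k<n. \<not> first_time P \<omega> \<le> enat k)"
    by (cases "first_time P \<omega>") (auto simp: not_le intro: antisym leI)
  also have "\<dots> \<longleftrightarrow> P n \<omega> \<and> (\<forall>k<n. \<not> P k \<omega>)"
  proof -
    have "(\<forall>k<n. \<not> (\<exists>i\<le>k. P i \<omega>)) \<longleftrightarrow> (\<forall>k<n. \<not> P k \<omega>)"
      by (meson le_refl order.strict_trans1)
    then show ?thesis unfolding first_time_le_iff by (auto simp: order.order_iff_strict)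
  qed
  finally show ?thesis .
qed

text \<open>The function is left arbitrary so that the same facts apply to the barycenter and to its
  truncations \<open>min \<Psi> m\<close>.\<close>

definition ay_time :: "(int \<Rightarrow> real) \<Rightarrow> (nat \<Rightarrow> 'a \<Rightarrow> int) \<Rightarrow> 'a \<Rightarrow> enat" where
  "ay_time \<Psi> X = first_time (\<lambda>n \<omega>. \<Psi> (X n \<omega>) \<le> real_of_int (running_max X n \<omega>))"

lemma azema_yor_time_eq: "azema_yor_time \<mu> X = ay_time (barycenter \<mu>) X"
  by (simp add: fun_eq_iff azema_yor_time_def ay_time_def first_time_def)

section \<open>Running maxima and crossings\<close>

lemma running_max_ge: "k \<le> n \<Longrightarrow> X k \<omega> \<le> running_max X n \<omega>"
  unfolding running_max_def by (rule Max_ge) auto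

lemma running_max_attained: "\<exists>k\<le>n. X k \<omega> = running_max X n \<omega>"
proof -
  have "running_max X n \<omega> \<in> (\<lambda>k. X k \<omega>) ` {..n}" unfolding running_max_def by (rule Max_in) auto
  then show ?thesis by (metis atMost_iff imageE)
qed

lemma running_max_ge_iff: "z \<le> running_max X n \<omega> \<longleftrightarrow> (\<exists>k\<le>n. z \<le> X k \<omega>)"
  by (metis order.trans running_max_attained running_max_ge)

lemma running_max_mono: "k \<le> n \<Longrightarrow> running_max X k \<omega> \<le> running_max X n \<omega>"
  by (metis le_trans running_max_attained running_max_ge)

lemma running_max_0: "running_max X 0 \<omega> = X 0 \<omega>"
  by (simp add: running_max_def)

text \<open>A discrete intermediate value theorem for descents: with steps of size at most 1, a path
  that starts above \<open>y\<close> and avoids it stays above it.\<close>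

lemma nearest_neighbour_hits:
  fixes x :: "nat \<Rightarrow> int"
  assumes "\<And>n. \<bar>x (Suc n) - x n\<bar> \<le> 1" "k \<le> n" "y \<le> x k" "x n \<le> y"
  shows "\<exists>i. k \<le> i \<and> i \<le> n \<and> x i = y"
proof (rule ccontr)
  assume no: "\<not> ?thesis"
  have "y < x i" if "k \<le> i" "i \<le> n" for i
    using that
  proof (induction i rule: dec_induct)
    case base
    then show ?case using no assms by force
  next
    case (step i)
    then have "y < x i" "x (Suc i) \<noteq> y" using no by auto
    then show ?case using assms(1)[of i] by linarith
  qed
  then show False using assms by fastforce
qed

section \<open>Single paths at the Azema--Yor time and at its truncations\<close>

locale nearest_neighbour_path =
  fixes X :: "nat \<Rightarrow> 'a \<Rightarrow> int" and \<omega> :: 'a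
  assumes start: "X 0 \<omega> = 0" and step: "\<And>n. \<bar>X (Suc n) \<omega> - X n \<omega>\<bar> \<le> 1"
begin

lemma running_max_nonneg: "0 \<le> running_max X n \<omega>"
  using running_max_ge[of 0 n X \<omega>] start by simp

text \<open>Left to right is monotonicity together with the stopping rule at \<open>t\<close>.
  Conversely, the maximum is at least \<open>y\<close> because \<open>y \<le> \<Psi> y\<close>, so a
  path ending below \<open>y\<close> comes down through \<open>y\<close> after attaining its
  maximum. The rule would hold at that visit, before \<open>t\<close>.\<close>

lemma le_position_at_ay_time_iff:
  assumes "mono \<Psi>" "\<And>y. real_of_int y \<le> \<Psi> y" and T: "ay_time \<Psi> X \<omega> = enat t"
  shows "y \<le> X t \<omega> \<longleftrightarrow> \<Psi> y \<le> real_of_int (running_max X t \<omega>)"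
proof
  have s: "\<Psi> (X t \<omega>) \<le> running_max X t \<omega>" 
    and n: "\<And>k. k < t \<Longrightarrow> \<not> \<Psi> (X k \<omega>) \<le> running_max X k \<omega>"
    using T unfolding ay_time_def first_time_eq_iff by auto
  show "\<Psi> y \<le> running_max X t \<omega>" if "y \<le> X t \<omega>"
    using monoD[OF assms(1) that] s by linarith
  show "y \<le> X t \<omega>" if y: "\<Psi> y \<le> running_max X t \<omega>"
  proof (rule ccontr)
    assume c: "\<not> y \<le> X t \<omega>"
    obtain k where k: "k \<le> t" "X k \<omega> = running_max X t \<omega>"
      using running_max_attained[of t X \<omega>] by blast
    have "y \<le> X k \<omega>" using assms(2)[of y] y k by linarith
    then obtain i where i: "k \<le> i" "i \<le> t" "X i \<omega> = y"
      using nearest_neighbour_hits[of "\<lambda>n. X n \<omega>" k t y] step k c by auto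
    have "i \<noteq> t" using i(3) c by auto
    then have "i < t" using i(2) by simp
    moreover have "running_max X t \<omega> \<le> running_max X i \<omega>"
      using running_max_ge[OF i(1), of X \<omega>] k by simp
    ultimately show False using n[of i] i y by force
  qed
qed

text \<open>While the maximum is below \<open>m\<close>, the truncated and the original rule agree;
  once it equals \<open>m\<close>, the truncated rule holds. Unit steps keep the maximum from
  overshooting \<open>m\<close>.\<close>

lemma ay_time_min_cases:
  fixes m :: int and \<Psi> :: "int \<Rightarrow> real"
  assumes m: "0 \<le> m" and T: "ay_time (\<lambda>y. min (\<Psi> y) m) X \<omega> = enat n"
  obtains "X n \<omega> = m" "running_max X n \<omega> = m"
  | "ay_time \<Psi> X \<omega> = enat n" "running_max X n \<omega> < m"
proof -
  have s: "min (\<Psi> (X n \<omega>)) m \<le> running_max X n \<omega>" 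
    and less: "\<And>k. k < n \<Longrightarrow> \<not> min (\<Psi> (X k \<omega>)) m \<le> running_max X k \<omega>"
    using T unfolding ay_time_def first_time_eq_iff by auto
  show ?thesis
  proof (cases "running_max X n \<omega> < m")
    case True
    have "ay_time \<Psi> X \<omega> = enat n"
      unfolding ay_time_def first_time_eq_iff using s less True by (auto simp: min_le_iff_disj)
    then show ?thesis using True that by blast
  next
    case False
    have "running_max X n \<omega> \<le> m"
    proof (cases n)
      case 0
      then show ?thesis using start m by (simp add: running_max_0)
    next
      case (Suc k)
      \<comment> \<open>The truncated rule failed at time \<open>k\<close>, so the maximum was still
        below \<open>m\<close>.\<close>
      then have k: "running_max X k \<omega> < m" using less[of k] by auto
      have "X i \<omega> \<le> m" if "i \<le> n" for i
      proof (cases "i = n")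
        case True
        then show ?thesis using k running_max_ge[of k k X \<omega>] step[of k] Suc by simp
      next
        case False
        then have "i \<le> k" using that Suc by simp
        then show ?thesis using k running_max_ge[of i k X \<omega>] by simp
      qed
      then show ?thesis using running_max_attained[of n X \<omega>] by metis
    qed
    then have rm: "running_max X n \<omega> = m" using False by simp
    then obtain i where i: "i \<le> n" "X i \<omega> = m"
      using running_max_attained[of n X \<omega>] by auto
    \<comment> \<open>At any visit to \<open>m\<close> the truncated rule holds, so no visit
      precedes \<open>n\<close>.\<close>
    have "i = n"
    proof (rule ccontr)
      assume "i \<noteq> n"
      then have "i < n" using i by simp
      then show False using less[of i] running_max_ge[of i i X \<omega>] i by auto
    qed
    then show ?thesis using that(1) rm i by blast
  qed
qed

lemma ay_time_min_le: "ay_time \<Psi> X \<omega> = enat t \<Longrightarrow> \<exists>n\<le>t. ay_time (\<lambda>y. min (\<Psi> y) m) X \<omega> = enat n"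
proof -
  assume "ay_time \<Psi> X \<omega> = enat t"
  then have "ay_time (\<lambda>y. min (\<Psi> y) m) X \<omega> \<le> enat t"
    unfolding ay_time_def first_time_le_iff first_time_eq_iff by (auto simp: min_le_iff_disj)
  then show ?thesis by (cases "ay_time (\<lambda>y. min (\<Psi> y) m) X \<omega>") auto
qed

text \<open>The second case of \<open>ay_time_min_cases\<close> would make the truncated time equal
  to \<open>t\<close>, where the maximum is at least \<open>m\<close>.\<close>

lemma at_ay_time_min_reached:
  fixes m :: int and \<Psi> :: "int \<Rightarrow> real"
  assumes "0 \<le> m" "ay_time \<Psi> X \<omega> = enat t" "m \<le> running_max X t \<omega>"
  shows "at_time X (ay_time (\<lambda>y. min (\<Psi> y) m) X) \<omega> = m"
proof -
  obtain n where n: "ay_time (\<lambda>y. min (\<Psi> y) m) X \<omega> = enat n" using ay_time_min_le[OF assms(2)] by blast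
  show ?thesis
    by (rule ay_time_min_cases[OF assms(1) n]) (use assms n in \<open>auto simp: at_time_def\<close>)
qed

lemma at_ay_time_min_not_reached:
  fixes m :: int and \<Psi> :: "int \<Rightarrow> real"
  assumes "0 \<le> m" "ay_time \<Psi> X \<omega> = enat t" "running_max X t \<omega> < m"
  shows "at_time X (ay_time (\<lambda>y. min (\<Psi> y) m) X) \<omega> = X t \<omega>"
proof -
  obtain n where n: "n \<le> t" "ay_time (\<lambda>y. min (\<Psi> y) m) X \<omega> = enat n" using ay_time_min_le[OF assms(2)] by blast
  show ?thesis
    by (rule ay_time_min_cases[OF assms(1) n(2)])
       (use assms n running_max_mono[OF n(1), of X \<omega>] in \<open>auto simp: at_time_def\<close>)
qed

text \<open>To get below \<open>a\<close> the path must first visit \<open>a\<close>, where the rule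
  holds because the maximum is never below the starting value 0.\<close>

lemma stopped_ge:
  assumes "\<Psi> a \<le> 0" "a \<le> 0"
  shows "a \<le> stopped X (ay_time \<Psi> X) n \<omega>"
proof -
  have "a \<le> X k \<omega>" if k: "enat k \<le> ay_time \<Psi> X \<omega>" for k
  proof (rule ccontr)
    assume c: "\<not> a \<le> X k \<omega>"
    then obtain i where i: "i \<le> k" "X i \<omega> = a"
      using nearest_neighbour_hits[of "\<lambda>n. X n \<omega>" 0 k a] step start assms by auto
    have "i \<noteq> k" using i(2) c by auto
    then have "i < k" using i(1) by simp
    moreover have "\<Psi> (X i \<omega>) \<le> running_max X i \<omega>"
      using i assms running_max_nonneg[of i] by simp
    then have "ay_time \<Psi> X \<omega> \<le> enat i" unfolding ay_time_def first_time_le_iff by blast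
    ultimately show False using k order_trans[of "enat k" "ay_time \<Psi> X \<omega>" "enat i"] by simp
  qed
  \<comment> \<open>The minimum with \<open>enat n\<close> is finite, so \<open>the_enat\<close>
    really inverts \<open>enat\<close> here.\<close>
  moreover have "enat (the_enat (min (enat n) (ay_time \<Psi> X \<omega>))) = min (enat n) (ay_time \<Psi> X \<omega>)"
    by (cases "ay_time \<Psi> X \<omega>") auto
  ultimately show ?thesis by (simp add: stopped_def)
qed

text \<open>Strictly before the truncated time the maximum is below \<open>m\<close>, and the next
  step adds at most 1.\<close>

lemma stopped_min_le:
  fixes m :: int and \<Psi> :: "int \<Rightarrow> real"
  assumes "0 \<le> m"
  shows "stopped X (ay_time (\<lambda>y. min (\<Psi> y) m) X) n \<omega> \<le> m"
proof -
  let ?S = "ay_time (\<lambda>y. min (\<Psi> y) m) X"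
  have *: "X k \<omega> \<le> m" if k: "enat k \<le> ?S \<omega>" for k
  proof (cases k)
    case 0
    then show ?thesis using start assms by simp
  next
    case (Suc i)
    then have "enat i < ?S \<omega>" using k by (metis Suc_ile_eq)
    then have "running_max X i \<omega> < m" unfolding ay_time_def less_first_time_iff by auto
    then show ?thesis using running_max_ge[of i i X \<omega>] step[of i] Suc by simp
  qed
  have "enat (the_enat (min (enat n) (?S \<omega>))) = min (enat n) (?S \<omega>)"
    by (cases "?S \<omega>") auto
  then show ?thesis using * by (simp add: stopped_def)
qed

end

section \<open>The stopped random walk\<close>

lemma measurable_count_space_add:
  fixes f g :: "'a \<Rightarrow> int"
  assumes "f \<in> measurable N (count_space UNIV)" "g \<in> measurable N (count_space UNIV)"
  shows "(\<lambda>x. f x + g x) \<in> measurable N (count_space UNIV)"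
  by (rule measurable_compose_countable[OF _ assms(1), of "\<lambda>i x. i + g x"])
     (rule measurable_compose[OF assms(2)], simp)

lemma measurable_count_space_sum:
  fixes f :: "'i \<Rightarrow> 'a \<Rightarrow> int"
  assumes "finite I" "\<And>i. i \<in> I \<Longrightarrow> f i \<in> measurable N (count_space UNIV)"
  shows "(\<lambda>x. \<Sum>i\<in>I. f i x) \<in> measurable N (count_space UNIV)"
  using assms by (induction rule: finite_induct) (auto intro: measurable_count_space_add)

lemma running_max_Suc: "running_max X (Suc n) \<omega> = max (X (Suc n) \<omega>) (running_max X n \<omega>)"
  unfolding running_max_def by (simp add: atMost_Suc)

lemma measurable_running_max:
  assumes "\<And>k. X k \<in> measurable N (count_space UNIV)"
  shows "running_max X n \<in> measurable N (count_space UNIV)"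
proof (induction n)
  case 0
  then show ?case using assms by (simp add: running_max_0[abs_def])
next
  case (Suc n)
  show ?case
    unfolding running_max_Suc[abs_def]
    by (rule measurable_compose_countable[OF _ assms, of "\<lambda>i x. max i (running_max X n x)"])
       (rule measurable_compose[OF Suc], simp)
qed

section \<open>Stopped sequences\<close>

lemma stopped_0: "stopped X \<tau> 0 \<omega> = X 0 \<omega>"
  unfolding stopped_def by (cases "\<tau> \<omega>") (auto simp: min_def zero_enat_def)

lemma stopped_Suc: "stopped X \<tau> (Suc n) \<omega> = (if enat n < \<tau> \<omega> then X (Suc n) \<omega> else stopped X \<tau> n \<omega>)"
  unfolding stopped_def by (cases "\<tau> \<omega>") (auto simp: min_def)

lemma stopped_eq: "enat n \<le> \<tau> \<omega> \<Longrightarrow> stopped X \<tau> n \<omega> = X n \<omega>"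
  by (simp add: stopped_def min_absorb1)

lemma stopped_eq_at_time: "\<tau> \<omega> \<le> enat n \<Longrightarrow> stopped X \<tau> n \<omega> = at_time X \<tau> \<omega>"
  by (simp add: stopped_def at_time_def min_absorb2)

lemma stopped_tendsto:
  assumes "\<tau> \<omega> < \<infinity>"
  shows "(\<lambda>n. f (stopped X \<tau> n \<omega>)) \<longlonglongrightarrow> f (at_time X \<tau> \<omega>)"
proof (rule tendsto_eventually)
  obtain t where t: "\<tau> \<omega> = enat t" using assms by (cases "\<tau> \<omega>") auto
  show "eventually (\<lambda>n. f (stopped X \<tau> n \<omega>) = f (at_time X \<tau> \<omega>)) sequentially"
    using eventually_ge_at_top[of t] by eventually_elim (simp add: stopped_eq_at_time t)
qed

section \<open>The natural filtration and the independence of the next step\<close>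

context simple_symmetric_steps
begin

abbreviation "W \<equiv> walk \<xi>"
abbreviation "\<F> \<equiv> natural_filtration M W"

lemma measurable_step: "1 \<le> k \<Longrightarrow> \<xi> k \<in> measurable M (count_space UNIV)"
  using indep_steps by (auto simp: indep_vars_def)

lemma measurable_walk: "W n \<in> measurable M (count_space UNIV)"
  unfolding walk_def by (intro measurable_count_space_sum measurable_step) auto

lemma walk_0: "W 0 \<omega> = 0"
  by (simp add: walk_def)

lemma walk_Suc: "W (Suc n) \<omega> = W n \<omega> + \<xi> (Suc n) \<omega>"
  by (simp add: walk_def)

lemma filtration_generator: 
  "space (\<F> n) = space M" "sets (\<F> n) = sigma_sets (space M) {W k -` A \<inter> space M | k A. k \<le> n}"
  unfolding natural_filtration_def by (auto intro!: space_measure_of sets_measure_of)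

lemma subalgebra_filtration: "subalgebra M (\<F> n)"
  unfolding subalgebra_def filtration_generator
  by (auto intro!: sets.sigma_sets_subset measurable_sets[OF measurable_walk])

lemma filtration_mono: "m \<le> n \<Longrightarrow> subalgebra (\<F> n) (\<F> m)"
  unfolding subalgebra_def filtration_generator
  by (intro conjI refl sigma_sets_mono') (auto intro: order_trans)

lemma measurable_walk_filtration: "k \<le> n \<Longrightarrow> W k \<in> measurable (\<F> n) (count_space UNIV)"
  by (rule measurableI) (auto simp: filtration_generator intro!: sigma_sets.Basic)

lemma AE_step: "1 \<le> k \<Longrightarrow> AE \<omega> in M. \<xi> k \<omega> = 1 \<or> \<xi> k \<omega> = - 1"
proof -
  assume k: "1 \<le> k"
  have [measurable]: "\<xi> k \<in> measurable M (count_space UNIV)" using measurable_step[OF k] .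
  have "prob ({\<omega>\<in>space M. \<xi> k \<omega> = 1} \<union> {\<omega>\<in>space M. \<xi> k \<omega> = - 1}) = 1/2 + 1/2"
    by (subst finite_measure_Union) (auto simp: prob_step_up[OF k] prob_step_down[OF k])
  then have "AE \<omega> in M. \<omega> \<in> {\<omega>\<in>space M. \<xi> k \<omega> = 1} \<union> {\<omega>\<in>space M. \<xi> k \<omega> = - 1}"
    by (intro AE_prob_1) simp
  then show ?thesis by eventually_elim auto
qed

text \<open>The steps are \<open>1\<close> or \<open>- 1\<close> only outside a null set, so the
  pathwise facts are applied by interpreting the locale at almost every
  \<open>\<omega>\<close>.\<close>

lemma AE_nearest_neighbour_path: "AE \<omega> in M. nearest_neighbour_path W \<omega>"
proof -
  have "AE \<omega> in M. \<forall>k. \<xi> (Suc k) \<omega> = 1 \<or> \<xi> (Suc k) \<omega> = - 1"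
    unfolding AE_all_countable using AE_step by auto
  then show ?thesis
  proof eventually_elim
    case (elim \<omega>)
    have "\<bar>W (Suc n) \<omega> - W n \<omega>\<bar> \<le> 1" for n
      using elim[rule_format, of n] by (auto simp: walk_Suc)
    then show ?case by unfold_locales (simp_all add: walk_0)
  qed
qed

lemma step_integral:
  assumes "1 \<le> k"
  shows "integrable M (\<lambda>\<omega>. real_of_int (\<xi> k \<omega>))" "(\<integral>\<omega>. real_of_int (\<xi> k \<omega>) \<partial>M) = 0"
proof -
  have [measurable]: "\<xi> k \<in> measurable M (count_space UNIV)" using measurable_step[OF assms] .
  have m[measurable]: "(\<lambda>\<omega>. real_of_int (\<xi> k \<omega>)) \<in> borel_measurable M" by measurable
  let ?g = "\<lambda>\<omega>. indicator {\<omega>\<in>space M. \<xi> k \<omega> = 1} \<omega> - indicator {\<omega>\<in>space M. \<xi> k \<omega> = - 1} \<omega> :: real"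
  have eq: "AE \<omega> in M. real_of_int (\<xi> k \<omega>) = ?g \<omega>"
    using AE_step[OF assms] AE_space by eventually_elim auto
  have i: "integrable M (indicator {\<omega>\<in>space M. \<xi> k \<omega> = c} :: 'a \<Rightarrow> real)" for c
    by (simp add: emeasure_finite less_top[symmetric])
  have g: "integrable M ?g" by (intro Bochner_Integration.integrable_diff i)
  have "(\<integral>\<omega>. ?g \<omega> \<partial>M) = prob {\<omega>\<in>space M. \<xi> k \<omega> = 1} - prob {\<omega>\<in>space M. \<xi> k \<omega> = - 1}"
    by (subst Bochner_Integration.integral_diff[OF i i]) (simp add: Int_absorb2 subset_iff)
  then have z: "(\<integral>\<omega>. ?g \<omega> \<partial>M) = 0"
    using prob_step_up[OF assms] prob_step_down[OF assms] by simp
  show "integrable M (\<lambda>\<omega>. real_of_int (\<xi> k \<omega>))"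
    using integrable_cong_AE[OF m _ eq] g by simp
  show "(\<integral>\<omega>. real_of_int (\<xi> k \<omega>) \<partial>M) = 0"
    using integral_cong_AE[OF m _ eq] z by simp
qed

text \<open>The blocks \<open>{1..n}\<close> and \<open>{Suc n}\<close> of increments are
  independent. Positions up to time \<open>n\<close> are functions of the first block, so
  \<open>\<F> n\<close> is contained in the sigma-algebra of that block, and \<open>Z\<close>
  inherits the independence.\<close>

lemma indep_past_step:
  assumes "Z \<in> borel_measurable (\<F> n)"
  shows "indep_var borel Z borel (\<lambda>\<omega>. real_of_int (\<xi> (Suc n) \<omega>))"
proof -
  let ?P = "PiM {1..n} (\<lambda>_. count_space (UNIV :: int set))"
  let ?Q = "PiM {Suc n} (\<lambda>_. count_space (UNIV :: int set))"
  let ?R = "\<lambda>\<omega>. restrict (\<lambda>i. \<xi> i \<omega>) {1..n}"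
  let ?\<xi> = "\<lambda>\<omega>. real_of_int (\<xi> (Suc n) \<omega>)"
  let ?R' = "\<lambda>\<omega>. restrict (\<lambda>i. \<xi> i \<omega>) {Suc n}"
  let ?GR = "sigma_sets (space M) {?R -` A \<inter> space M | A. A \<in> sets ?P}"
  let ?GR' = "sigma_sets (space M) {?R' -` A \<inter> space M | A. A \<in> sets ?Q}"
  let ?GZ = "sigma_sets (space M) {Z -` A \<inter> space M | A. A \<in> sets borel}"
  let ?GX = "sigma_sets (space M) {?\<xi> -` A \<inter> space M | A. A \<in> sets borel}"
  have "indep_var ?P ?R ?Q ?R'"
    by (rule indep_var_restrict[OF indep_steps]) auto
  then have ind: "indep_set ?GR ?GR'" unfolding indep_var_eq by auto
  have rvX: "random_variable borel ?\<xi>"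
    using measurable_compose[OF measurable_step[of "Suc n"], of real_of_int borel] by simp
  have GX: "?GX \<subseteq> ?GR'"
  proof (rule sigma_sets_mono', safe)
    fix A :: "real set"
    let ?s = "\<lambda>f::nat \<Rightarrow> int. f (Suc n)"
    have s: "?s \<in> measurable ?Q (count_space UNIV)"
      by (rule measurable_component_singleton) simp
    have "?\<xi> -` A \<inter> space M = ?R' -` (?s -` (real_of_int -` A) \<inter> space ?Q) \<inter> space M"
      by (auto simp: space_PiM)
    moreover have "?s -` (real_of_int -` A) \<inter> space ?Q \<in> sets ?Q"
      using s by (rule measurable_sets) simp
    ultimately show "\<exists>B. ?\<xi> -` A \<inter> space M = ?R' -` B \<inter> space M \<and> B \<in> sets ?Q" by blast
  qed
  have FR: "sets (\<F> n) \<subseteq> ?GR"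
    unfolding filtration_generator
  proof (rule sigma_sets_mono, safe)
    fix k A assume "k \<le> n"
    let ?s = "\<lambda>f::nat \<Rightarrow> int. \<Sum>i=1..k. f i"
    have s: "?s \<in> measurable ?P (count_space UNIV)"
      using \<open>k \<le> n\<close> by (intro measurable_count_space_sum measurable_component_singleton) auto
    have "W k -` A \<inter> space M = ?R -` (?s -` A \<inter> space ?P) \<inter> space M"
      using \<open>k \<le> n\<close> by (auto simp: walk_def space_PiM)
    moreover have "?s -` A \<inter> space ?P \<in> sets ?P"
      using s by (rule measurable_sets) simp
    ultimately show "W k -` A \<inter> space M \<in> ?GR" by (intro sigma_sets.Basic) blast
  qed
  have "?GZ \<subseteq> sets (\<F> n)"
  proof -
    have "Z -` A \<inter> space M \<in> sets (\<F> n)" if "A \<in> sets borel" for A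
      using measurable_sets[OF assms that] by (simp add: filtration_generator)
    then have "{Z -` A \<inter> space M | A. A \<in> sets borel} \<subseteq> sets (\<F> n)" by auto
    then show ?thesis using sets.sigma_sets_subset[of _ "\<F> n"] by (simp add: filtration_generator(1))
  qed
  then have "?GZ \<subseteq> ?GR" using FR by blast
  then have "indep_set ?GZ ?GX"
    using ind GX unfolding indep_sets2_eq by blast
  moreover have "random_variable borel Z"
    using measurable_from_subalg[OF subalgebra_filtration assms] .
  ultimately show ?thesis unfolding indep_var_eq using rvX by auto
qed

text \<open>Independence factors the expectation, and the step has mean zero. Both the martingale
  identity and the growth of the second moment are drawn from this.\<close>

lemma past_step:
  assumes "Z \<in> borel_measurable (\<F> n)" "integrable M Z"
  shows "integrable M (\<lambda>\<omega>. Z \<omega> * real_of_int (\<xi> (Suc n) \<omega>))" "(\<integral>\<omega>. Z \<omega> * real_of_int (\<xi> (Suc n) \<omega>) \<partial>M) = 0"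
proof -
  have s: "integrable M (\<lambda>\<omega>. real_of_int (\<xi> (Suc n) \<omega>))" "(\<integral>\<omega>. real_of_int (\<xi> (Suc n) \<omega>) \<partial>M) = 0"
    using step_integral[of "Suc n"] by auto
  show "integrable M (\<lambda>\<omega>. Z \<omega> * real_of_int (\<xi> (Suc n) \<omega>))"
    using indep_var_integrable[OF indep_past_step[OF assms(1)] assms(2) s(1)] .
  show "(\<integral>\<omega>. Z \<omega> * real_of_int (\<xi> (Suc n) \<omega>) \<partial>M) = 0"
    using indep_var_lebesgue_integral[OF indep_past_step[OF assms(1)] assms(2) s(1)] s(2) by simp
qed

section \<open>Stopping times and the stopped martingale\<close>

definition stops :: "('a \<Rightarrow> enat) \<Rightarrow> bool" where
  "stops \<tau> \<longleftrightarrow> (\<forall>n. Measurable.pred (\<F> n) (\<lambda>\<omega>. \<tau> \<omega> \<le> enat n))"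

lemma stops_ay_time: "stops (ay_time \<Psi> W)"
proof -
  have "Measurable.pred (\<F> n) (\<lambda>\<omega>. ay_time \<Psi> W \<omega> \<le> enat n)" for n
  proof -
    have "Measurable.pred (\<F> n) (\<lambda>\<omega>. \<Psi> (W k \<omega>) \<le> real_of_int (W i \<omega>))"
      if "k \<in> {..n}" "i \<in> {..k}" for k i
    proof -
      have k: "W k \<in> measurable (\<F> n) (count_space UNIV)" and i: "W i \<in> measurable (\<F> n) (count_space UNIV)"
        using that by (auto intro: measurable_walk_filtration)
      show ?thesis
        by (rule measurable_compose_countable[OF _ k, of "\<lambda>j \<omega>. \<Psi> j \<le> real_of_int (W i \<omega>)"])
           (rule measurable_compose[OF i], simp)
    qed
    then have "Measurable.pred (\<F> n) (\<lambda>\<omega>. \<exists>k\<in>{..n}. \<exists>i\<in>{..k}. \<Psi> (W k \<omega>) \<le> real_of_int (W i \<omega>))"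
      by (intro pred_intros_finite) auto
    moreover
    \<comment> \<open>Writing the maximum as an existential over earlier times makes the event a
      finite union of conditions on pairs of positions.\<close>
    have "ay_time \<Psi> W \<omega> \<le> enat n \<longleftrightarrow> (\<exists>k\<in>{..n}. \<exists>i\<in>{..k}. \<Psi> (W k \<omega>) \<le> real_of_int (W i \<omega>))" for \<omega>
    proof -
      \<comment> \<open>The maximum is an integer, so the real threshold may be rounded up.\<close>
      have "\<Psi> (W k \<omega>) \<le> real_of_int (running_max W k \<omega>) \<longleftrightarrow> (\<exists>i\<le>k. \<Psi> (W k \<omega>) \<le> real_of_int (W i \<omega>))" for k
        using running_max_ge_iff[of "\<lceil>\<Psi> (W k \<omega>)\<rceil>" W k \<omega>] by (simp add: ceiling_le_iff)
      then show ?thesis by (auto simp: ay_time_def first_time_le_iff)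
    qed
    ultimately show ?thesis by simp
  qed
  then show ?thesis by (simp add: stops_def)
qed

context
  fixes \<tau> :: "'a \<Rightarrow> enat"
  assumes stops: "stops \<tau>"
begin

lemma pred_stopping_le: "n \<le> N \<Longrightarrow> Measurable.pred (\<F> N) (\<lambda>\<omega>. \<tau> \<omega> \<le> enat n)"
  using stops measurable_from_subalg[OF filtration_mono] unfolding stops_def by blast

lemma pred_less_stopping: "n \<le> N \<Longrightarrow> Measurable.pred (\<F> N) (\<lambda>\<omega>. enat n < \<tau> \<omega>)"
  using pred_stopping_le[of n N] by (simp add: not_le[symmetric])

lemma pred_stopping_le_M[measurable]: "Measurable.pred M (\<lambda>\<omega>. \<tau> \<omega> \<le> enat n)"
  using measurable_from_subalg[OF subalgebra_filtration pred_stopping_le] by blast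

lemma measurable_stopping: "\<tau> \<in> measurable M (count_space UNIV)"
proof -
  have fin: "Measurable.pred M (\<lambda>\<omega>. \<tau> \<omega> = enat n)" for n
  proof -
    have "\<tau> \<omega> = enat n \<longleftrightarrow> \<tau> \<omega> \<le> enat n \<and> (\<forall>k\<in>{..<n}. \<not> \<tau> \<omega> \<le> enat k)" for \<omega>
      by (cases "\<tau> \<omega>") (auto simp: not_le intro: antisym leI)
    then show ?thesis by simp
  qed
  have inf: "Measurable.pred M (\<lambda>\<omega>. \<tau> \<omega> = \<infinity>)"
  proof -
    have "\<tau> \<omega> = \<infinity> \<longleftrightarrow> (\<forall>n. \<not> \<tau> \<omega> \<le> enat n)" for \<omega>
      by (cases "\<tau> \<omega>") auto
    then show ?thesis by simp
  qed
  have "{\<omega>\<in>space M. \<tau> \<omega> = a} \<in> sets M" for a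
    using fin inf by (cases a) auto
  then have "\<tau> -` {a} \<inter> space M \<in> sets M" for a
    by (simp add: vimage_def Int_def conj_commute)
  then show ?thesis
    by (subst measurable_count_space_eq_countable) auto
qed

lemma measurable_at_time: "(\<And>n. X n \<in> measurable M (count_space UNIV)) \<Longrightarrow> at_time X \<tau> \<in> measurable M (count_space UNIV)"
  unfolding at_time_def[abs_def]
  by (rule measurable_compose_countable[of X]) (auto intro: measurable_compose[OF measurable_stopping])

lemma measurable_stopped_filtration: "n \<le> N \<Longrightarrow> stopped W \<tau> n \<in> measurable (\<F> N) (count_space UNIV)"
proof (induction n)
  case 0
  then show ?case by (simp add: stopped_0[abs_def] walk_0[abs_def])
next
  case (Suc n)
  have [measurable]: "Measurable.pred (\<F> N) (\<lambda>\<omega>. enat n < \<tau> \<omega>)"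
    "W (Suc n) \<in> measurable (\<F> N) (count_space UNIV)"
    "stopped W \<tau> n \<in> measurable (\<F> N) (count_space UNIV)"
    using Suc by (auto intro: pred_less_stopping measurable_walk_filtration)
  have "stopped W \<tau> (Suc n) = (\<lambda>\<omega>. if enat n < \<tau> \<omega> then W (Suc n) \<omega> else stopped W \<tau> n \<omega>)"
    by (simp add: fun_eq_iff stopped_Suc)
  then show ?case by simp
qed

abbreviation "Y n \<omega> \<equiv> real_of_int (stopped W \<tau> n \<omega>)"

lemma measurable_Y_filtration: "n \<le> N \<Longrightarrow> Y n \<in> borel_measurable (\<F> N)"
  by (rule measurable_compose[OF measurable_stopped_filtration]) auto

lemma measurable_Y[measurable]: "Y n \<in> borel_measurable M"
  using measurable_from_subalg[OF subalgebra_filtration measurable_Y_filtration] by blast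

text \<open>The stopped walk is a martingale transform of the walk: whether the next step is taken
  is already decided at time \<open>n\<close>.\<close>

lemma Y_Suc: "Y (Suc n) \<omega> = Y n \<omega> + indicator {\<omega>. enat n < \<tau> \<omega>} \<omega> * real_of_int (\<xi> (Suc n) \<omega>)"
  by (auto simp: stopped_Suc walk_Suc stopped_eq[of n \<tau> \<omega>] indicator_def)

lemma measurable_indicator_less_stopping:
  "(indicator {\<omega>. enat n < \<tau> \<omega>} :: 'a \<Rightarrow> real) \<in> borel_measurable (\<F> n)"
  using pred_less_stopping[of n n] by (intro borel_measurable_indicator') auto

lemma integrable_Y: "integrable M (Y n)"
proof (induction n)
  case 0
  then show ?case by (simp add: stopped_0 walk_0)
next
  case (Suc n)
  have "integrable M (\<lambda>\<omega>. indicator {\<omega>. enat n < \<tau> \<omega>} \<omega> :: real)"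
    using measurable_from_subalg[OF subalgebra_filtration measurable_indicator_less_stopping[of n]]
    by (intro integrable_const_bound[where B = 1]) auto
  then show ?case
    unfolding Y_Suc using Suc past_step(1)[OF measurable_indicator_less_stopping] by simp
qed

text \<open>Each further step contributes a factor known at time \<open>n\<close> times a step of
  mean zero. This integrated form characterizes conditional expectations and survives limits in
  L1.\<close>

lemma integral_indicator_stopped_eq:
  assumes "A \<in> sets (\<F> m)" "m \<le> n"
  shows "(\<integral>\<omega>. indicator A \<omega> * Y n \<omega> \<partial>M) = (\<integral>\<omega>. indicator A \<omega> * Y m \<omega> \<partial>M)"
  using assms(2)
proof (induction n rule: dec_induct)
  case (step n)
  have AM: "A \<in> sets M" using assms(1) subalgebra_filtration by (auto simp: subalgebra_def)
  have An: "A \<in> sets (\<F> n)" using assms(1) filtration_mono[OF step(1)] by (auto simp: subalgebra_def)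
  let ?Z = "\<lambda>\<omega>. indicator A \<omega> * indicator {\<omega>. enat n < \<tau> \<omega>} \<omega> :: real"
  have Z: "?Z \<in> borel_measurable (\<F> n)"
    using An by (intro borel_measurable_times measurable_indicator_less_stopping) auto
  have iZ: "integrable M ?Z"
    using measurable_from_subalg[OF subalgebra_filtration Z]
    by (intro integrable_const_bound[where B = 1]) (auto simp: indicator_def)
  have "(\<integral>\<omega>. indicator A \<omega> * Y (Suc n) \<omega> \<partial>M)
     = (\<integral>\<omega>. indicator A \<omega> * Y n \<omega> + ?Z \<omega> * real_of_int (\<xi> (Suc n) \<omega>) \<partial>M)"
    unfolding Y_Suc by (simp add: algebra_simps)
  also have "\<dots> = (\<integral>\<omega>. indicator A \<omega> * Y n \<omega> \<partial>M) + (\<integral>\<omega>. ?Z \<omega> * real_of_int (\<xi> (Suc n) \<omega>) \<partial>M)"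
    using integrable_mult_indicator[OF AM integrable_Y[of n]] past_step(1)[OF Z iZ]
    by (intro Bochner_Integration.integral_add) auto
  finally show ?case using step past_step(2)[OF Z iZ] by simp
qed simp

lemma expectation_Y: "(\<integral>\<omega>. Y n \<omega> \<partial>M) = 0"
proof -
  have "space M \<in> sets (\<F> 0)" using sets.top[of "\<F> 0"] by (simp add: filtration_generator)
  then have "(\<integral>\<omega>. indicator (space M) \<omega> * Y n \<omega> \<partial>M) = (\<integral>\<omega>. indicator (space M) \<omega> * Y 0 \<omega> \<partial>M)"
    by (rule integral_indicator_stopped_eq) simp
  moreover have "(\<integral>\<omega>. indicator (space M) \<omega> * Y k \<omega> \<partial>M) = (\<integral>\<omega>. Y k \<omega> \<partial>M)" for k
    by (rule Bochner_Integration.integral_cong) auto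
  ultimately show ?thesis by (simp add: stopped_0 walk_0)
qed

lemma martingale_stopped: "martingale M \<F> Y"
  unfolding martingale_def
proof (intro conjI allI impI)
  show "subalgebra M (\<F> n)" for n by (rule subalgebra_filtration)
  show "sets (\<F> m) \<subseteq> sets (\<F> n)" if "m \<le> n" for m n
    using filtration_mono[OF that] by (simp add: subalgebra_def)
  show "Y n \<in> borel_measurable (\<F> n)" for n by (rule measurable_Y_filtration) simp
  show "integrable M (Y n)" for n by (rule integrable_Y)
  show "AE \<omega> in M. real_cond_exp M (\<F> m) (Y n) \<omega> = Y m \<omega>" if "m \<le> n" for m n
  proof -
    interpret finite_measure_subalgebra M "\<F> m"
      by unfold_locales (rule subalgebra_filtration)
    show ?thesis
      by (rule real_cond_exp_charact)
         (auto simp: set_lebesgue_integral_def integral_indicator_stopped_eq[OF _ that] integrable_Y measurable_Y_filtration)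
  qed
qed

text \<open>Each step before \<open>\<tau>\<close> increases the second moment by the probability that it is made;
  a bounded second moment leaves room for finitely many steps only.\<close>

lemma AE_finite_if_bounded:
  assumes "\<And>n. AE \<omega> in M. \<bar>Y n \<omega>\<bar> \<le> C"
  shows "AE \<omega> in M. \<tau> \<omega> < \<infinity>"
proof -
  have [measurable]: "\<tau> \<in> measurable M (count_space UNIV)" by (rule measurable_stopping)
  have i2: "integrable M (\<lambda>\<omega>. (Y n \<omega>)\<^sup>2)" for n
  proof (rule integrable_const_bound[where B = "C\<^sup>2"])
    show "AE \<omega> in M. norm ((Y n \<omega>)\<^sup>2) \<le> C\<^sup>2"
      using assms[of n]
    proof eventually_elim
      case (elim \<omega>)
      then have "\<bar>Y n \<omega>\<bar>\<^sup>2 \<le> C\<^sup>2" by (intro power_mono) auto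
      then show ?case by simp
    qed
  qed measurable
  have le2: "(\<integral>\<omega>. (Y n \<omega>)\<^sup>2 \<partial>M) \<le> C\<^sup>2" for n
  proof -
    have "(\<integral>\<omega>. (Y n \<omega>)\<^sup>2 \<partial>M) \<le> (\<integral>\<omega>. C\<^sup>2 \<partial>M)"
    proof (rule integral_mono_AE[OF i2])
      show "AE \<omega> in M. (Y n \<omega>)\<^sup>2 \<le> C\<^sup>2"
        using assms[of n]
      proof eventually_elim
        case (elim \<omega>)
        then have "\<bar>Y n \<omega>\<bar>\<^sup>2 \<le> C\<^sup>2" by (intro power_mono) auto
        then show ?case by simp
      qed
    qed simp
    then show ?thesis by (simp add: prob_space)
  qed
  have inc: "(\<integral>\<omega>. (Y (Suc n) \<omega>)\<^sup>2 \<partial>M) = (\<integral>\<omega>. (Y n \<omega>)\<^sup>2 \<partial>M) + prob {\<omega>\<in>space M. enat n < \<tau> \<omega>}" for n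
  proof -
    let ?I = "\<lambda>\<omega>. indicator {\<omega>. enat n < \<tau> \<omega>} \<omega> :: real"
    let ?J = "\<lambda>\<omega>. indicator {\<omega>\<in>space M. enat n < \<tau> \<omega>} \<omega> :: real"
    let ?Z = "\<lambda>\<omega>. 2 * Y n \<omega> * ?I \<omega>"
    have mI[measurable]: "?I \<in> borel_measurable M"
      using measurable_from_subalg[OF subalgebra_filtration measurable_indicator_less_stopping] .
    have [measurable]: "\<xi> (Suc n) \<in> measurable M (count_space UNIV)" by (rule measurable_step) simp
    have Z: "?Z \<in> borel_measurable (\<F> n)"
      using measurable_indicator_less_stopping[of n] measurable_Y_filtration[of n n] by simp
    have iZ: "integrable M ?Z"
    proof (rule Bochner_Integration.integrable_bound[of _ "\<lambda>\<omega>. 2 * Y n \<omega>"])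
      show "integrable M (\<lambda>\<omega>. 2 * Y n \<omega>)" using integrable_Y[of n] by simp
      show "AE \<omega> in M. norm (?Z \<omega>) \<le> norm (2 * Y n \<omega>)" by (auto simp: indicator_def)
    qed measurable
    have iJ: "integrable M ?J" by (simp add: emeasure_finite less_top[symmetric])
    \<comment> \<open>The squared step is 1 almost surely, so expanding the square leaves a cross
      term of mean zero and the indicator that the step is made.\<close>
    have "(\<integral>\<omega>. (Y (Suc n) \<omega>)\<^sup>2 \<partial>M) = (\<integral>\<omega>. (Y n \<omega>)\<^sup>2 + ?Z \<omega> * real_of_int (\<xi> (Suc n) \<omega>) + ?J \<omega> \<partial>M)"
    proof (rule integral_cong_AE)
      show "AE \<omega> in M. (Y (Suc n) \<omega>)\<^sup>2 = (Y n \<omega>)\<^sup>2 + ?Z \<omega> * real_of_int (\<xi> (Suc n) \<omega>) + ?J \<omega>"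
        using AE_step[of "Suc n", simplified] AE_space
        by eventually_elim (auto simp: Y_Suc indicator_def power2_eq_square algebra_simps)
    qed measurable
    also have "\<dots> = (\<integral>\<omega>. (Y n \<omega>)\<^sup>2 \<partial>M) + (\<integral>\<omega>. ?Z \<omega> * real_of_int (\<xi> (Suc n) \<omega>) \<partial>M) + (\<integral>\<omega>. ?J \<omega> \<partial>M)"
      using i2[of n] past_step(1)[OF Z iZ] iJ
      by (simp only: Bochner_Integration.integral_add Bochner_Integration.integrable_add)
    also have "(\<integral>\<omega>. ?J \<omega> \<partial>M) = prob {\<omega>\<in>space M. enat n < \<tau> \<omega>}"
      by (simp add: Int_absorb2 subset_iff)
    finally show ?thesis using past_step(2)[OF Z iZ] by simp
  qed
  let ?p = "prob {\<omega>\<in>space M. \<tau> \<omega> = \<infinity>}"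
  have "real n * ?p \<le> (\<integral>\<omega>. (Y n \<omega>)\<^sup>2 \<partial>M)" for n
  proof (induction n)
    case (Suc n)
    have "?p \<le> prob {\<omega>\<in>space M. enat n < \<tau> \<omega>}"
      by (rule finite_measure_mono) (auto simp: less_top)
    then show ?case using Suc inc[of n] by (simp add: algebra_simps)
  qed simp
  then have b: "real n * ?p \<le> C\<^sup>2" for n using le2[of n] order_trans by blast
  have "?p = 0"
  proof (rule ccontr)
    assume "?p \<noteq> 0"
    then have "?p > 0" using measure_nonneg[of M] by (simp add: less_le)
    then obtain n where "C\<^sup>2 < real n * ?p" using reals_Archimedean3 by blast
    then show False using b[of n] by simp
  qed
  then have "AE \<omega> in M. \<omega> \<notin> {\<omega>\<in>space M. \<tau> \<omega> = \<infinity>}"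
    by (subst (asm) prob_eq_0) auto
  then show ?thesis using AE_space by eventually_elim (simp add: less_top)
qed

text \<open>The stopped walk has mean zero at every time and converges to the position at
  \<open>\<tau>\<close>; the bound allows dominated convergence.\<close>

lemma bounded_optional_stopping:
  assumes "\<And>n. AE \<omega> in M. \<bar>Y n \<omega>\<bar> \<le> C"
  shows "integrable M (\<lambda>\<omega>. real_of_int (at_time W \<tau> \<omega>))" "(\<integral>\<omega>. real_of_int (at_time W \<tau> \<omega>) \<partial>M) = 0"
proof -
  have [measurable]: "at_time W \<tau> \<in> measurable M (count_space UNIV)"
    by (rule measurable_at_time) (rule measurable_walk)
  have lim: "AE \<omega> in M. (\<lambda>n. Y n \<omega>) \<longlonglongrightarrow> real_of_int (at_time W \<tau> \<omega>)"
    using AE_finite_if_bounded[OF assms] by eventually_elim (rule stopped_tendsto)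
  have bd: "AE \<omega> in M. norm (Y n \<omega>) \<le> C" for n using assms[of n] by simp
  show "integrable M (\<lambda>\<omega>. real_of_int (at_time W \<tau> \<omega>))"
    by (rule integrable_dominated_convergence[OF _ _ _ lim bd]) auto
  have "(\<lambda>n. \<integral>\<omega>. Y n \<omega> \<partial>M) \<longlonglongrightarrow> (\<integral>\<omega>. real_of_int (at_time W \<tau> \<omega>) \<partial>M)"
    by (rule integral_dominated_convergence[OF _ _ _ lim bd]) auto
  then show "(\<integral>\<omega>. real_of_int (at_time W \<tau> \<omega>) \<partial>M) = 0"
    unfolding expectation_Y by (simp add: LIMSEQ_const_iff)
qed

end

text \<open>Scheffe's lemma gives convergence in L1, so the position at \<open>\<tau>\<close> closes
  the martingale. Where the stopped walk exceeds \<open>K\<close>, so does the maximum up to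
  \<open>\<tau>\<close>; that event is the same for all \<open>n\<close> and shrinks to the empty
  set, so dominated convergence bounds all tail integrals at once.\<close>

lemma uniformly_integrable_stopped:
  assumes \<tau>: "stops \<tau>"
    and finite: "AE \<omega> in M. \<tau> \<omega> < \<infinity>"
    and integrable: "integrable M (\<lambda>\<omega>. real_of_int (at_time W \<tau> \<omega>))"
    and mean: "(\<integral>\<omega>. real_of_int (at_time W \<tau> \<omega>) \<partial>M) = 0"
    and bound: "AE \<omega> in M. \<forall>n. a \<le> stopped W \<tau> n \<omega>"
  shows "uniformly_integrable M UNIV (\<lambda>n \<omega>. real_of_int (stopped W \<tau> n \<omega>))"
proof -
  let ?Y = "\<lambda>n \<omega>. real_of_int (stopped W \<tau> n \<omega>)"
  let ?Z = "\<lambda>\<omega>. real_of_int (at_time W \<tau> \<omega>)"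
  \<comment> \<open>The maximum up to \<open>\<tau>\<close> dominates the stopped walk at every
    time.\<close>
  let ?D = "\<lambda>\<omega>. real_of_int (at_time (running_max W) \<tau> \<omega>)"
  have mY[measurable]: "?Y n \<in> borel_measurable M" for n by (rule measurable_Y[OF \<tau>])
  have iY: "integrable M (?Y n)" for n by (rule integrable_Y[OF \<tau>])
  have "at_time (running_max W) \<tau> \<in> measurable M (count_space UNIV)"
    by (intro measurable_at_time[OF \<tau>] measurable_running_max measurable_walk)
  then have mD[measurable]: "?D \<in> borel_measurable M" by measurable
  have lim: "AE \<omega> in M. (\<lambda>n. ?Y n \<omega>) \<longlonglongrightarrow> ?Z \<omega>"
    using finite by eventually_elim (rule stopped_tendsto)
  have Z_ge: "AE \<omega> in M. a \<le> ?Z \<omega>"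
    using bound finite
  proof eventually_elim
    case (elim \<omega>)
    then obtain t where "\<tau> \<omega> = enat t" by auto
    then have "stopped W \<tau> t \<omega> = at_time W \<tau> \<omega>" by (intro stopped_eq_at_time) simp
    then show ?case using elim(1) by (metis of_int_le_iff)
  qed
  have Y_ge: "AE \<omega> in M. a \<le> ?Y n \<omega>" for n using bound by eventually_elim simp
  \<comment> \<open>After a shift by the lower bound the norm is the function itself, so its
    integral depends only on the mean; the hypothesis of Scheffe's lemma then holds with
    equality.\<close>
  have norm_eq: "(\<integral>\<^sup>+\<omega>. ennreal (norm (f \<omega> - real_of_int a)) \<partial>M) = ennreal (- a)"
    if "integrable M f" "(\<integral>\<omega>. f \<omega> \<partial>M) = 0" "AE \<omega> in M. a \<le> f \<omega>" for f :: "'a \<Rightarrow> real"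
  proof -
    have "(\<integral>\<^sup>+\<omega>. ennreal (norm (f \<omega> - real_of_int a)) \<partial>M) = (\<integral>\<^sup>+\<omega>. ennreal (f \<omega> - real_of_int a) \<partial>M)"
      by (rule nn_integral_cong_AE) (use that(3) in eventually_elim, simp)
    also have "\<dots> = ennreal (\<integral>\<omega>. f \<omega> - real_of_int a \<partial>M)"
      by (rule nn_integral_eq_integral) (use that in auto)
    also have "(\<integral>\<omega>. f \<omega> - real_of_int a \<partial>M) = - a"
      using that by (simp add: prob_space)
    finally show ?thesis .
  qed
  have "(\<lambda>n. \<integral>\<^sup>+\<omega>. norm ((?Y n \<omega> - real_of_int a) - (?Z \<omega> - real_of_int a)) \<partial>M) \<longlonglongrightarrow> 0"
  proof (rule Scheffe_lemma2)
    show "AE \<omega> in M. (\<lambda>n. ?Y n \<omega> - real_of_int a) \<longlonglongrightarrow> ?Z \<omega> - real_of_int a"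
      using lim by eventually_elim (intro tendsto_intros)
    show "(\<integral>\<^sup>+\<omega>. norm (?Y n \<omega> - real_of_int a) \<partial>M) \<le> (\<integral>\<^sup>+\<omega>. norm (?Z \<omega> - real_of_int a) \<partial>M)" for n
      using norm_eq[OF iY expectation_Y[OF \<tau>] Y_ge, of n] norm_eq[OF integrable mean Z_ge] by simp
  qed (use integrable in auto)
  then have "(\<lambda>n. \<integral>\<^sup>+\<omega>. norm (?Y n \<omega> - ?Z \<omega>) \<partial>M) \<longlonglongrightarrow> 0" by simp
  also have "(\<lambda>n. \<integral>\<^sup>+\<omega>. norm (?Y n \<omega> - ?Z \<omega>) \<partial>M) = (\<lambda>n. ennreal (\<integral>\<omega>. norm (?Y n \<omega> - ?Z \<omega>) \<partial>M))"
    by (intro ext nn_integral_eq_integral integrable_norm Bochner_Integration.integrable_diff iY integrable) auto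
  finally have L1: "(\<lambda>n. \<integral>\<omega>. norm (?Y n \<omega> - ?Z \<omega>) \<partial>M) \<longlonglongrightarrow> 0"
    using tendsto_ennrealD[of "\<lambda>n. \<integral>\<omega>. norm (?Y n \<omega> - ?Z \<omega>) \<partial>M" 0 sequentially] by (simp add: integral_nonneg_AE)
  \<comment> \<open>The left side is unchanged when \<open>n\<close> is replaced by a later
    \<open>N\<close>, so its distance to the right side is at most the L1 distance at
    \<open>N\<close>.\<close>
  have closed: "(\<integral>\<omega>. indicator A \<omega> * ?Y n \<omega> \<partial>M) = (\<integral>\<omega>. indicator A \<omega> * ?Z \<omega> \<partial>M)"
    if A: "A \<in> sets (\<F> n)" for A n
  proof -
    have AM: "A \<in> sets M" using A subalgebra_filtration by (auto simp: subalgebra_def)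
    have iA: "integrable M (\<lambda>\<omega>. indicator A \<omega> * f \<omega>)" if "integrable M f" for f :: "'a \<Rightarrow> real"
      using integrable_mult_indicator[OF AM that] by simp
    have "\<bar>(\<integral>\<omega>. indicator A \<omega> * ?Y n \<omega> \<partial>M) - (\<integral>\<omega>. indicator A \<omega> * ?Z \<omega> \<partial>M)\<bar>
        \<le> (\<integral>\<omega>. norm (?Y N \<omega> - ?Z \<omega>) \<partial>M)" if "n \<le> N" for N
    proof -
      have "(\<integral>\<omega>. indicator A \<omega> * ?Y n \<omega> \<partial>M) - (\<integral>\<omega>. indicator A \<omega> * ?Z \<omega> \<partial>M)
          = (\<integral>\<omega>. indicator A \<omega> * ?Y N \<omega> \<partial>M) - (\<integral>\<omega>. indicator A \<omega> * ?Z \<omega> \<partial>M)"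
        using integral_indicator_stopped_eq[OF \<tau> A that] by simp
      also have "\<dots> = (\<integral>\<omega>. indicator A \<omega> * (?Y N \<omega> - ?Z \<omega>) \<partial>M)"
        using iA[OF iY] iA[OF integrable] by (simp add: right_diff_distrib)
      also have "\<bar>\<dots>\<bar> \<le> (\<integral>\<omega>. \<bar>indicator A \<omega> * (?Y N \<omega> - ?Z \<omega>)\<bar> \<partial>M)"
        by (rule integral_abs_bound)
      also have "\<dots> \<le> (\<integral>\<omega>. norm (?Y N \<omega> - ?Z \<omega>) \<partial>M)"
      proof (rule integral_mono)
        have "integrable M (\<lambda>\<omega>. ?Y N \<omega> - ?Z \<omega>)" using iY integrable by simp
        then show "integrable M (\<lambda>\<omega>. norm (?Y N \<omega> - ?Z \<omega>))"
          and "integrable M (\<lambda>\<omega>. \<bar>indicator A \<omega> * (?Y N \<omega> - ?Z \<omega>)\<bar>)"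
          by (rule integrable_norm, intro integrable_abs iA)
        show "\<bar>indicator A \<omega> * (?Y N \<omega> - ?Z \<omega>)\<bar> \<le> norm (?Y N \<omega> - ?Z \<omega>)" for \<omega>
          by (auto simp: indicator_def)
      qed
      finally show ?thesis .
    qed
    then have "\<bar>(\<integral>\<omega>. indicator A \<omega> * ?Y n \<omega> \<partial>M) - (\<integral>\<omega>. indicator A \<omega> * ?Z \<omega> \<partial>M)\<bar> \<le> 0"
      by (intro LIMSEQ_le_const[OF L1]) blast
    then show ?thesis by simp
  qed
  let ?g = "\<lambda>K::real. \<integral>\<omega>. \<bar>?Z \<omega>\<bar> * indicator {\<omega>. ?D \<omega> > K} \<omega> \<partial>M"
  have ig: "integrable M (\<lambda>\<omega>. \<bar>?Z \<omega>\<bar> * indicator {\<omega>. ?D \<omega> > K} \<omega>)" for K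
    by (rule Bochner_Integration.integrable_bound[OF integrable]) (use integrable in \<open>auto simp: indicator_def\<close>)
  have g0: "(?g \<longlongrightarrow> (\<integral>\<omega>. 0 \<partial>M)) at_top"
  proof (rule integral_dominated_convergence_at_top[where w = "\<lambda>\<omega>. \<bar>?Z \<omega>\<bar>"])
    show "AE \<omega> in M. ((\<lambda>K. \<bar>?Z \<omega>\<bar> * indicator {\<omega>. ?D \<omega> > K} \<omega>) \<longlongrightarrow> 0) at_top"
    proof (rule AE_I2, rule tendsto_eventually)
      fix \<omega>
      show "eventually (\<lambda>K. \<bar>?Z \<omega>\<bar> * indicator {\<omega>. ?D \<omega> > K} \<omega> = 0) at_top"
        using eventually_ge_at_top[of "?D \<omega>"] by eventually_elim simp
    qed
    show "eventually (\<lambda>K. AE \<omega> in M. norm (\<bar>?Z \<omega>\<bar> * indicator {\<omega>. ?D \<omega> > K} \<omega>) \<le> \<bar>?Z \<omega>\<bar>) at_top"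
      by (intro always_eventually allI AE_I2) (auto simp: indicator_def)
  qed (use integrable in auto)
  have le: "(\<integral>\<^sup>+\<omega>. ennreal \<bar>?Y n \<omega>\<bar> * indicator {\<omega>. \<bar>?Y n \<omega>\<bar> > K} \<omega> \<partial>M) \<le> ennreal (?g K)"
    if K: "\<bar>real_of_int a\<bar> \<le> K" for n K
  proof -
    let ?A = "{\<omega>\<in>space M. ?Y n \<omega> > K}"
    have [measurable]: "?Y n \<in> borel_measurable (\<F> n)" using measurable_Y_filtration[OF \<tau>] by blast
    have "{\<omega>\<in>space (\<F> n). ?Y n \<omega> > K} \<in> sets (\<F> n)" by measurable
    then have A: "?A \<in> sets (\<F> n)" by (simp add: filtration_generator)
    then have AM[measurable]: "?A \<in> sets M" using subalgebra_filtration by (auto simp: subalgebra_def)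
    have iA: "integrable M (\<lambda>\<omega>. indicator ?A \<omega> * f \<omega>)" if "integrable M f" for f :: "'a \<Rightarrow> real"
      using integrable_mult_indicator[OF AM that] by simp
    have "(\<integral>\<^sup>+\<omega>. ennreal \<bar>?Y n \<omega>\<bar> * indicator {\<omega>. \<bar>?Y n \<omega>\<bar> > K} \<omega> \<partial>M)
        = (\<integral>\<^sup>+\<omega>. ennreal (indicator ?A \<omega> * ?Y n \<omega>) \<partial>M)"
    proof (rule nn_integral_cong_AE)
      show "AE \<omega> in M. ennreal \<bar>?Y n \<omega>\<bar> * indicator {\<omega>. \<bar>?Y n \<omega>\<bar> > K} \<omega> = ennreal (indicator ?A \<omega> * ?Y n \<omega>)"
        using Y_ge[of n] AE_space
      proof eventually_elim
        case (elim \<omega>)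
        \<comment> \<open>Since \<open>K\<close> is at least the modulus of the lower bound, no
          value lies below \<open>- K\<close>.\<close>
        then have "\<bar>?Y n \<omega>\<bar> > K \<longleftrightarrow> ?Y n \<omega> > K" using K by linarith
        moreover have "\<bar>?Y n \<omega>\<bar> = ?Y n \<omega>" if "?Y n \<omega> > K" using K that by linarith
        ultimately show ?case using elim(2) by (auto simp: indicator_def)
      qed
    qed
    also have "\<dots> = ennreal (\<integral>\<omega>. indicator ?A \<omega> * ?Y n \<omega> \<partial>M)"
      by (rule nn_integral_eq_integral[OF iA[OF iY]]) (use K in \<open>auto simp: indicator_def\<close>)
    also have "\<dots> = ennreal (\<integral>\<omega>. indicator ?A \<omega> * ?Z \<omega> \<partial>M)"
      using closed[OF A] by simp
    also have "\<dots> \<le> ennreal (?g K)"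
    proof (intro ennreal_leI integral_mono_AE iA integrable ig)
      show "AE \<omega> in M. indicator ?A \<omega> * ?Z \<omega> \<le> \<bar>?Z \<omega>\<bar> * indicator {\<omega>. ?D \<omega> > K} \<omega>"
        using finite
      proof eventually_elim
        case (elim \<omega>)
        then obtain t where t: "\<tau> \<omega> = enat t" by auto
        have "stopped W \<tau> n \<omega> = W (min n t) \<omega>" by (simp add: stopped_def t)
        also have "\<dots> \<le> at_time (running_max W) \<tau> \<omega>"
          unfolding at_time_def by (simp add: t running_max_ge)
        finally have "?Y n \<omega> \<le> ?D \<omega>" by simp
        then show ?case by (auto simp: indicator_def)
      qed
    qed
    finally show ?thesis .
  qed
  show ?thesis
    unfolding uniformly_integrable_def
  proof (intro conjI ballI)
    show "((\<lambda>K::real. SUP i\<in>UNIV. \<integral>\<^sup>+\<omega>. ennreal \<bar>?Y i \<omega>\<bar> * indicator {\<omega>. \<bar>?Y i \<omega>\<bar> > K} \<omega> \<partial>M) \<longlongrightarrow> 0) at_top"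
    proof (rule tendsto_sandwich[where f = "\<lambda>_. 0" and h = "\<lambda>K. ennreal (?g K)"])
      show "eventually (\<lambda>K. (SUP i\<in>UNIV. \<integral>\<^sup>+\<omega>. ennreal \<bar>?Y i \<omega>\<bar> * indicator {\<omega>. \<bar>?Y i \<omega>\<bar> > K} \<omega> \<partial>M) \<le> ennreal (?g K)) at_top"
        using eventually_ge_at_top[of "\<bar>real_of_int a\<bar>"] by eventually_elim (intro SUP_least le)
      show "((\<lambda>K. ennreal (?g K)) \<longlongrightarrow> 0) at_top"
        using tendsto_ennrealI[OF g0] by simp
    qed auto
  qed (rule mY)
qed

section \<open>The Azema--Yor stopping time\<close>

text \<open>The stopped walk stays between \<open>a\<close> and \<open>m\<close>, so bounded
  optional stopping applies.\<close>

lemma at_ay_time_min: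
  fixes \<Psi> :: "int \<Rightarrow> real" and m a :: int
  assumes "\<Psi> a \<le> 0" "a \<le> 0" "0 \<le> m"
  defines "S \<equiv> ay_time (\<lambda>y. min (\<Psi> y) m) W"
  shows "AE \<omega> in M. S \<omega> < \<infinity>"
    and "integrable M (\<lambda>\<omega>. real_of_int (at_time W S \<omega>))"
    and "(\<integral>\<omega>. real_of_int (at_time W S \<omega>) \<partial>M) = 0"
proof -
  have bd: "AE \<omega> in M. \<bar>real_of_int (stopped W S n \<omega>)\<bar> \<le> max (- a) m" for n
    using AE_nearest_neighbour_path
  proof eventually_elim
    case (elim \<omega>)
    then interpret nearest_neighbour_path W \<omega> .
    have "a \<le> stopped W S n \<omega>" "stopped W S n \<omega> \<le> m"
      unfolding S_def using assms by (auto intro!: stopped_ge stopped_min_le min.coboundedI1)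
    then show ?case by linarith
  qed
  have S: "stops S" unfolding S_def by (rule stops_ay_time)
  show "AE \<omega> in M. S \<omega> < \<infinity>" by (rule AE_finite_if_bounded[OF S bd])
  show "integrable M (\<lambda>\<omega>. real_of_int (at_time W S \<omega>))" "(\<integral>\<omega>. real_of_int (at_time W S \<omega>) \<partial>M) = 0"
    using bounded_optional_stopping[OF S bd] by auto
qed

section \<open>Position and maximum at the Azema--Yor time\<close>

context
  fixes \<mu> :: "int pmf"
  assumes centered: "centered \<mu>"
begin

abbreviation "\<Psi> \<equiv> barycenter \<mu>"
abbreviation "T \<equiv> ay_time \<Psi> W"

lemma measurable_at_T: "at_time W T \<in> measurable M (count_space UNIV)"
  by (intro measurable_at_time stops_ay_time measurable_walk)

lemma embeds_moments:
  fixes f :: "int \<Rightarrow> real"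
  assumes "embeds M W T \<mu>"
  shows "AE \<omega> in M. T \<omega> < \<infinity>"
    and "integrable M (\<lambda>\<omega>. real_of_int (at_time W T \<omega>))"
    and "(\<integral>\<omega>. real_of_int (at_time W T \<omega>) \<partial>M) = 0"
    and "(\<integral>\<omega>. f (at_time W T \<omega>) \<partial>M) = (\<integral>y. f y \<partial>measure_pmf \<mu>)"
    and "prob {\<omega>\<in>space M. x \<le> at_time W T \<omega>} = tail \<mu> x"
proof -
  have d: "distr M (count_space UNIV) (at_time W T) = measure_pmf \<mu>"
    and "AE \<omega> in M. T \<omega> < \<infinity>"
    using assms by (auto simp: embeds_def)
  then show "AE \<omega> in M. T \<omega> < \<infinity>" by simp
  have *: "(\<integral>\<omega>. f (at_time W T \<omega>) \<partial>M) = (\<integral>y. f y \<partial>measure_pmf \<mu>)" for f :: "int \<Rightarrow> real"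
    unfolding d[symmetric] by (rule integral_distr[symmetric, OF measurable_at_T]) simp
  show "(\<integral>\<omega>. f (at_time W T \<omega>) \<partial>M) = (\<integral>y. f y \<partial>measure_pmf \<mu>)" by (rule *)
  show "integrable M (\<lambda>\<omega>. real_of_int (at_time W T \<omega>))"
    using centered_integrable[OF centered] unfolding d[symmetric]
    by (subst (asm) integrable_distr_eq[OF measurable_at_T]) auto
  show "(\<integral>\<omega>. real_of_int (at_time W T \<omega>) \<partial>M) = 0"
    using *[of real_of_int] centered_expectation[OF centered] by simp
  have "tail \<mu> x = measure (distr M (count_space UNIV) (at_time W T)) {x..}"
    by (simp add: d tail_def)
  also have "\<dots> = prob (at_time W T -` {x..} \<inter> space M)"
    by (rule measure_distr[OF measurable_at_T]) simp
  also have "at_time W T -` {x..} \<inter> space M = {\<omega>\<in>space M. x \<le> at_time W T \<omega>}" by auto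
  finally show "prob {\<omega>\<in>space M. x \<le> at_time W T \<omega>} = tail \<mu> x" by simp
qed

text \<open>The quantifier over \<open>x\<close> stands inside the almost sure statement so that the
  random point \<open>at_time W T \<omega>\<close> may be inserted for \<open>x\<close>.\<close>

lemma AE_le_at_T_iff:
  assumes "AE \<omega> in M. T \<omega> < \<infinity>"
  shows "AE \<omega> in M. \<forall>x. x \<le> at_time W T \<omega> \<longleftrightarrow> \<Psi> x \<le> at_time (running_max W) T \<omega>"
  using assms AE_nearest_neighbour_path
proof eventually_elim
  case (elim \<omega>)
  then interpret nearest_neighbour_path W \<omega> by simp
  obtain t where t: "T \<omega> = enat t" using elim by auto
  show ?case
    using le_position_at_ay_time_iff[of \<Psi> t] mono_barycenter[OF centered] le_barycenter[OF centered] t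
    by (simp add: at_time_def)
qed

lemma AE_at_min_T:
  fixes m :: int
  assumes "AE \<omega> in M. T \<omega> < \<infinity>" "0 \<le> m"
  shows "AE \<omega> in M. at_time W (ay_time (\<lambda>y. min (\<Psi> y) m) W) \<omega> =
    (if m \<le> at_time (running_max W) T \<omega> then m else at_time W T \<omega>)"
  using assms(1) AE_nearest_neighbour_path
proof eventually_elim
  case (elim \<omega>)
  then interpret nearest_neighbour_path W \<omega> by simp
  obtain t where t: "T \<omega> = enat t" using elim by auto
  show ?case
    using at_ay_time_min_reached[of m \<Psi> t] at_ay_time_min_not_reached[of m \<Psi> t] assms(2) t
    by (auto simp: at_time_def[of _ "ay_time \<Psi> W"] not_le)
qed

text \<open>If the barycenter were positive everywhere, the walk could not stop before its maximum
  is at least 1. Any \<open>c\<close> with \<open>\<Psi> c < 1\<close> would then satisfy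
  \<open>c \<le> W T\<close> almost surely, so \<open>\<mu>\<close> would have no mass below
  \<open>c\<close>, and \<open>\<Psi> c\<close> would be the total mean 0.\<close>

lemma barycenter_vanishes_if_embeds:
  assumes emb: "embeds M W T \<mu>"
  shows "\<exists>a. \<Psi> a = 0"
proof (rule ccontr)
  assume no: "\<nexists>a. \<Psi> a = 0"
  have pos: "0 < \<Psi> x" for x
    using barycenter_nonneg[OF centered, of x] no by (auto simp: less_le)
  obtain c where c: "\<Psi> c < 1" using barycenter_less_1[OF centered] by auto
  have "AE \<omega> in M. c \<le> at_time W T \<omega>"
    using AE_le_at_T_iff[OF embeds_moments(1)[OF emb]]
  proof eventually_elim
    case (elim \<omega>)
    have "\<Psi> (at_time W T \<omega>) \<le> at_time (running_max W) T \<omega>" using elim by blast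
    then have "0 < at_time (running_max W) T \<omega>" using pos[of "at_time W T \<omega>"] by linarith
    then have "\<Psi> c \<le> at_time (running_max W) T \<omega>" using c by linarith
    then show ?case using elim by blast
  qed
  then have "prob {\<omega>\<in>space M. c \<le> at_time W T \<omega>} = 1"
    using measurable_at_T by (intro prob_Collect_eq_1[THEN iffD2]) auto
  then have "tail \<mu> c = 1" using embeds_moments(5)[OF emb] by simp
  then show False using barycenter_eq_0_if_tail_1[OF centered] no by auto
qed

text \<open>The level \<open>m\<close> is reached by time \<open>T\<close> exactly if \<open>x \<le> W T\<close>, where \<open>m\<close> is the ceiling of
  \<open>\<Psi> x\<close>. Since the walk has mean zero both at \<open>T\<close> and at its truncation, so does
  \<open>(W T - m)\<close> on this event, which makes \<open>m\<close> the barycenter at \<open>x\<close>.\<close>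

lemma barycenter_Nats_if_embeds:
  assumes emb: "embeds M W T \<mu>"
  shows "\<Psi> x \<in> \<nat>"
proof -
  define m where "m = \<lceil>\<Psi> x\<rceil>"
  have p0: "0 \<le> \<Psi> x" using barycenter_nonneg[OF centered] by simp
  then have m: "0 \<le> m" by (simp add: m_def)
  \<comment> \<open>This zero bounds the truncated walk from below, which gives its terminal
    position mean zero.\<close>
  obtain a where a: "\<Psi> a = 0" using barycenter_vanishes_if_embeds[OF emb] by blast
  then have a0: "a \<le> 0" using le_barycenter[OF centered, of a] by simp
  note fin = embeds_moments(1)[OF emb]
  let ?V = "\<lambda>\<omega>. real_of_int (at_time W (ay_time (\<lambda>y. min (\<Psi> y) m) W) \<omega>)"
  let ?Z = "\<lambda>\<omega>. real_of_int (at_time W T \<omega>)"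
  have V: "integrable M ?V" "(\<integral>\<omega>. ?V \<omega> \<partial>M) = 0"
    using at_ay_time_min[of \<Psi> a m] a a0 m by auto
  note Z = embeds_moments(2,3)[OF emb]
  have eq: "AE \<omega> in M. ?Z \<omega> - ?V \<omega> = indicator {x..} (at_time W T \<omega>) * (?Z \<omega> - m)"
    using AE_le_at_T_iff[OF fin] AE_at_min_T[OF fin m]
  proof eventually_elim
    case (elim \<omega>)
    \<comment> \<open>The maximum is an integer, so exceeding \<open>\<Psi> x\<close> and exceeding
      its ceiling are the same.\<close>
    have "x \<le> at_time W T \<omega> \<longleftrightarrow> m \<le> at_time (running_max W) T \<omega>"
      using elim(1) by (simp add: m_def ceiling_le_iff)
    then show ?case using elim(2) by (auto simp: indicator_def)
  qed
  have [measurable]: "(\<lambda>\<omega>. f (at_time W T \<omega>)) \<in> borel_measurable M" for f :: "int \<Rightarrow> real"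
    by (rule measurable_compose[OF measurable_at_T]) simp
  have "0 = (\<integral>\<omega>. ?Z \<omega> - ?V \<omega> \<partial>M)" using V Z by simp
  also have "\<dots> = (\<integral>\<omega>. indicator {x..} (at_time W T \<omega>) * (?Z \<omega> - m) \<partial>M)"
    by (rule integral_cong_AE[OF _ _ eq]) (use V in auto)
  also have "\<dots> = (\<integral>y. indicator {x..} y * (real_of_int y - m) \<partial>measure_pmf \<mu>)"
    using embeds_moments(4)[OF emb, of "\<lambda>y. indicator {x..} y * (real_of_int y - m)"] by simp
  also have "\<dots> = (\<integral>y. indicator {x..} y * real_of_int y - m * indicat_real {x..} y \<partial>measure_pmf \<mu>)"
    by (simp add: algebra_simps)
  also have "\<dots> = tail_mean \<mu> x - m * tail \<mu> x"
    using integrable_pmf_indicator_mult[OF centered, of "{x..}"] integrable_pmf_indicator[of \<mu> "{x..}"]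
    by (subst Bochner_Integration.integral_diff) (auto simp: tail_mean_eq[OF centered] tail_def)
  also have "\<dots> = (\<Psi> x - m) * tail \<mu> x"
    by (simp add: tail_mean_eq_barycenter[OF centered] algebra_simps)
  finally have "\<Psi> x = m \<or> tail \<mu> x = 0" by auto
  \<comment> \<open>Where the tail vanishes, the default value \<open>x\<close> of the barycenter is
    an integer.\<close>
  then have "\<Psi> x \<in> \<int>" by (auto simp: barycenter_def)
  then show ?thesis using p0 by (simp add: Nats_altdef2)
qed

section \<open>Integer barycenters give an embedding\<close>

context
  assumes Nats: "\<And>x. \<Psi> x \<in> \<nat>"
begin

text \<open>A natural number below 1 is 0, and \<open>a \<le> \<Psi> a\<close> gives the sign of
  \<open>a\<close>.\<close>

lemma barycenter_vanishes_if_Nats: "\<exists>a. \<Psi> a = 0 \<and> a \<le> 0"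
proof -
  obtain c where c: "\<Psi> c < 1" using barycenter_less_1[OF centered] by auto
  obtain k where "\<Psi> c = real k" using Nats[of c] by (auto elim: Nats_cases)
  then have "\<Psi> c = 0" using c by simp
  then show ?thesis using le_barycenter[OF centered, of c] by (intro exI[of _ c]) simp
qed

lemma floor_barycenter: "real_of_int \<lfloor>\<Psi> x\<rfloor> = \<Psi> x"
proof -
  obtain n where "\<Psi> x = real n" using Nats[of x] by (auto elim: Nats_cases)
  then show ?thesis by simp
qed

lemma floor_barycenter_nonneg: "0 \<le> \<lfloor>\<Psi> x\<rfloor>"
  using Nats[of x] by (auto elim: Nats_cases)

lemma floor_barycenter_mono: "x \<le> y \<Longrightarrow> \<lfloor>\<Psi> x\<rfloor> \<le> \<lfloor>\<Psi> y\<rfloor>"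
  using monoD[OF mono_barycenter[OF centered], of x y] by (simp add: floor_mono)

abbreviation "V m \<equiv> at_time W (ay_time (\<lambda>y. min (\<Psi> y) (real_of_int m)) W)"
text \<open>For \<open>0 \<le> m\<close> this is, up to a null set, the event that the walk attains
  level \<open>m\<close> no later than \<open>T\<close>: a path stopped earlier ends strictly below
  \<open>m\<close>.\<close>

abbreviation "reached m \<equiv> {\<omega>\<in>space M. V m \<omega> = m}"

lemma measurable_V[measurable]: "V m \<in> measurable M (count_space UNIV)"
  by (intro measurable_at_time stops_ay_time measurable_walk)

text \<open>\<open>V m\<close> and \<open>V j\<close> differ only if \<open>j\<close> is reached. If
  \<open>m\<close> is reached too, the difference is \<open>m - j\<close>; otherwise the walk stops
  exactly at \<open>x\<close>, and it is \<open>x - j\<close>. Both positions have mean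
  zero.\<close>

lemma reached_recursion:
  fixes x :: int
  defines "j \<equiv> \<lfloor>\<Psi> x\<rfloor>" and "m \<equiv> \<lfloor>\<Psi> (x + 1)\<rfloor>"
  shows "(\<Psi> (x + 1) - x) * prob (reached m) = (\<Psi> x - x) * prob (reached j)"
proof -
  have j: "0 \<le> j" "real_of_int j = \<Psi> x" and m: "0 \<le> m" "real_of_int m = \<Psi> (x + 1)" and jm: "j \<le> m"
    using floor_barycenter floor_barycenter_nonneg floor_barycenter_mono[of x "x + 1"] by (auto simp: j_def m_def)
  obtain a where a: "\<Psi> a = 0" "a \<le> 0" using barycenter_vanishes_if_Nats by blast
  have V: "AE \<omega> in M. ay_time (\<lambda>y. min (\<Psi> y) (real_of_int i)) W \<omega> < \<infinity>"
    "integrable M (\<lambda>\<omega>. real_of_int (V i \<omega>))" "(\<integral>\<omega>. real_of_int (V i \<omega>) \<partial>M) = 0" if "0 \<le> i" for i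
    using at_ay_time_min[of \<Psi> a i] a that by auto
  have eq: "AE \<omega> in M. real_of_int (V m \<omega>) - real_of_int (V j \<omega>) =
    (m - x) * indicat_real (reached m) \<omega> + (x - j) * indicat_real (reached j) \<omega>"
    using V(1)[OF m(1)] AE_nearest_neighbour_path AE_space
  proof eventually_elim
    case (elim \<omega>)
    then interpret nearest_neighbour_path W \<omega> by simp
    obtain n where n: "ay_time (\<lambda>y. min (\<Psi> y) (real_of_int m)) W \<omega> = enat n" using elim by auto
    have Vm: "V m \<omega> = W n \<omega>" by (simp add: at_time_def n)
    show ?case
    proof (rule ay_time_min_cases[OF m(1) n])
      assume "W n \<omega> = m" and r: "running_max W n \<omega> = m"
      \<comment> \<open>The time \<open>T\<close> may be infinite on this path, so the pathwise
        lemma is applied to \<open>min \<Psi> m\<close> instead of \<open>\<Psi>\<close>; truncating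
        again at \<open>j \<le> m\<close> gives the truncation at \<open>j\<close>.\<close>
      have "(\<lambda>y. min (min (\<Psi> y) (real_of_int m)) (real_of_int j)) = (\<lambda>y. min (\<Psi> y) (real_of_int j))"
        using jm by (auto simp: fun_eq_iff min_def)
      then have "V j \<omega> = j"
        using at_ay_time_min_reached[OF j(1) n] r jm by simp
      then show ?thesis using Vm \<open>W n \<omega> = m\<close> elim by simp
    next
      assume T: "ay_time \<Psi> W \<omega> = enat n" and r: "running_max W n \<omega> < m"
      have nm: "V m \<omega> \<noteq> m" using Vm r running_max_ge[of n n W \<omega>] by simp
      have pos: "y \<le> W n \<omega> \<longleftrightarrow> \<Psi> y \<le> running_max W n \<omega>" for y
        by (rule le_position_at_ay_time_iff[OF _ _ T])
           (auto simp: mono_barycenter[OF centered] le_barycenter[OF centered])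
      show ?thesis
      proof (cases "j \<le> running_max W n \<omega>")
        case True
        then have "V j \<omega> = j" using at_ay_time_min_reached[OF j(1) T] by simp
        \<comment> \<open>The maximum lies between \<open>\<Psi> x\<close> and
          \<open>\<Psi> (x + 1)\<close>, strictly below the latter, which pins the position to
          \<open>x\<close>.\<close>
        moreover have "x \<le> W n \<omega>" "\<not> x + 1 \<le> W n \<omega>"
          using pos[of x] pos[of "x + 1"] True r j m by auto
        then have "W n \<omega> = x" by simp
        ultimately show ?thesis using Vm nm elim by simp
      next
        case False
        then have "V j \<omega> = W n \<omega>" using at_ay_time_min_not_reached[OF j(1) T] by simp
        moreover have "W n \<omega> < j" using False running_max_ge[of n n W \<omega>] by simp
        ultimately show ?thesis using Vm nm elim by simp
      qed
    qed
  qed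
  have ir: "integrable M (indicator (reached i) :: 'a \<Rightarrow> real)" for i
    by (simp add: emeasure_finite less_top[symmetric])
  have "0 = (\<integral>\<omega>. real_of_int (V m \<omega>) - real_of_int (V j \<omega>) \<partial>M)"
    using V[OF m(1)] V[OF j(1)] by simp
  also have "\<dots> = (\<integral>\<omega>. (m - x) * indicat_real (reached m) \<omega> + (x - j) * indicat_real (reached j) \<omega> \<partial>M)"
    by (rule integral_cong_AE[OF _ _ eq]) auto
  also have "\<dots> = (m - x) * prob (reached m) + (x - j) * prob (reached j)"
    using ir[of m] ir[of j]
    by (subst Bochner_Integration.integral_add) (auto simp: Int_absorb2 subset_iff)
  finally show ?thesis using j(2) m(2) by (simp add: algebra_simps)
qed

text \<open>Both sides satisfy the same recursion in \<open>x\<close> and agree at a zero of the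
  barycenter.\<close>

lemma prob_reached: "prob (reached \<lfloor>\<Psi> x\<rfloor>) = tail \<mu> x"
proof -
  obtain a where a: "\<Psi> a = 0" "a \<le> 0" using barycenter_vanishes_if_Nats by blast
  \<comment> \<open>At and to the left of a zero of \<open>\<Psi>\<close> the level is 0, which is
    reached at time 0, and the tail is 1.\<close>
  have base: "prob (reached \<lfloor>\<Psi> y\<rfloor>) = tail \<mu> y" if "y \<le> a" for y
  proof -
    have "\<lfloor>\<Psi> a\<rfloor> = 0" using a by simp
    then have y: "\<lfloor>\<Psi> y\<rfloor> = 0"
      using floor_barycenter_nonneg[of y] floor_barycenter_mono[OF that] by linarith
    then have "\<Psi> y = 0" using floor_barycenter[of y] by simp
    then have "tail \<mu> y = 1" by (auto intro: tail_1_if_barycenter_0[OF centered])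
    moreover have "ay_time (\<lambda>y. min (\<Psi> y) (real_of_int 0)) W \<omega> = enat 0" for \<omega>
      unfolding ay_time_def first_time_eq_iff by (simp add: running_max_0 walk_0)
    then have "reached 0 = space M" by (auto simp: at_time_def walk_0)
    ultimately show ?thesis using y by (simp add: prob_space)
  qed
  show ?thesis
  proof (cases "x \<le> a")
    case False
    then have "a \<le> x" by simp
    then show ?thesis
    proof (induction x rule: int_ge_induct)
      case (step x)
      \<comment> \<open>This factor multiplies both new terms and can be cancelled.\<close>
      have "0 < \<Psi> (x + 1) - x" using le_barycenter[OF centered, of "x + 1"] by simp
      moreover have "(\<Psi> (x + 1) - x) * prob (reached \<lfloor>\<Psi> (x + 1)\<rfloor>) = (\<Psi> (x + 1) - x) * tail \<mu> (x + 1)"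
        unfolding reached_recursion step.IH
        using barycenter_recursion[OF centered, of x] by (simp only: mult.commute)
      ultimately show ?case by simp
    qed (rule base, simp)
  qed (rule base)
qed

text \<open>A path on which the rule never holds can end its truncated runs only at the truncation
  levels, so it reaches every level \<open>\<Psi> x\<close>. The probability of that is the tail at
  \<open>x\<close>, which tends to 0.\<close>

lemma AE_T_finite: "AE \<omega> in M. T \<omega> < \<infinity>"
proof -
  obtain a where a: "\<Psi> a = 0" "a \<le> 0" using barycenter_vanishes_if_Nats by blast
  have [measurable]: "T \<in> measurable M (count_space UNIV)"
    by (rule measurable_stopping[OF stops_ay_time])
  let ?p = "prob {\<omega>\<in>space M. T \<omega> = \<infinity>}"
  have "?p \<le> tail \<mu> x" for x
  proof -
    let ?m = "\<lfloor>\<Psi> x\<rfloor>"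
    have "AE \<omega> in M. ay_time (\<lambda>y. min (\<Psi> y) (real_of_int ?m)) W \<omega> < \<infinity>"
      using at_ay_time_min(1)[of \<Psi> a ?m] a floor_barycenter_nonneg[of x] by auto
    then have "AE \<omega> in M. \<omega> \<in> {\<omega>\<in>space M. T \<omega> = \<infinity>} \<longrightarrow> \<omega> \<in> reached ?m"
      using AE_nearest_neighbour_path
    proof eventually_elim
      case (elim \<omega>)
      then interpret nearest_neighbour_path W \<omega> by simp
      obtain n where n: "ay_time (\<lambda>y. min (\<Psi> y) (real_of_int ?m)) W \<omega> = enat n" using elim by auto
      show ?case
        by (rule ay_time_min_cases[OF floor_barycenter_nonneg n]) (auto simp: at_time_def n)
    qed
    then have "?p \<le> prob (reached ?m)" by (intro finite_measure_mono_AE) auto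
    then show ?thesis by (simp add: prob_reached)
  qed
  then have "?p \<le> 0" by (intro LIMSEQ_le_const[OF tail_tendsto_0]) blast
  then have p0: "?p = 0" by (simp add: measure_le_0_iff)
  have "{\<omega>\<in>space M. T \<omega> = \<infinity>} \<in> events" by measurable
  then have "AE \<omega> in M. \<omega> \<notin> {\<omega>\<in>space M. T \<omega> = \<infinity>}"
    using p0 prob_eq_0 by blast
  then show ?thesis using AE_space by eventually_elim (simp add: less_top)
qed

text \<open>As \<open>\<Psi> x\<close> is an integer, \<open>le_position_at_ay_time_iff\<close>
  identifies the event with reaching the level \<open>\<Psi> x\<close>.\<close>

lemma prob_le_at_T: "prob {\<omega>\<in>space M. x \<le> at_time W T \<omega>} = tail \<mu> x"
proof -
  have [measurable]: "at_time W T \<in> measurable M (count_space UNIV)" by (rule measurable_at_T)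
  have "AE \<omega> in M. \<omega> \<in> {\<omega>\<in>space M. x \<le> at_time W T \<omega>} \<longleftrightarrow> \<omega> \<in> reached \<lfloor>\<Psi> x\<rfloor>"
    using AE_le_at_T_iff[OF AE_T_finite] AE_at_min_T[OF AE_T_finite floor_barycenter_nonneg[of x]] AE_T_finite
  proof eventually_elim
    case (elim \<omega>)
    obtain t where t: "T \<omega> = enat t" using elim by auto
    \<comment> \<open>If the level is not reached, \<open>V\<close> equals the position at
      \<open>T\<close>, which this keeps strictly below the level.\<close>
    have "at_time W T \<omega> \<le> at_time (running_max W) T \<omega>"
      by (simp add: at_time_def running_max_ge)
    moreover have "x \<le> at_time W T \<omega> \<longleftrightarrow> \<lfloor>\<Psi> x\<rfloor> \<le> at_time (running_max W) T \<omega>"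
      using elim(1)[rule_format, of x] floor_barycenter[of x] by (metis of_int_le_iff)
    ultimately show ?case using elim(2) by auto
  qed
  then have "prob {\<omega>\<in>space M. x \<le> at_time W T \<omega>} = prob (reached \<lfloor>\<Psi> x\<rfloor>)"
    by (intro finite_measure_eq_AE) auto
  then show ?thesis by (simp add: prob_reached)
qed

text \<open>A law on the integers is determined by its atoms, which are differences of successive
  tails.\<close>

lemma embeds_if_Nats: "embeds M W T \<mu>"
proof -
  have m[measurable]: "at_time W T \<in> measurable M (count_space UNIV)" by (rule measurable_at_T)
  interpret D: prob_space "distr M (count_space UNIV) (at_time W T)"
    by (rule prob_space_distr[OF m])
  have "prob (at_time W T -` {x} \<inter> space M) = pmf \<mu> x" for x
  proof -
    have "{\<omega>\<in>space M. x \<le> at_time W T \<omega>} = (at_time W T -` {x} \<inter> space M) \<union> {\<omega>\<in>space M. x + 1 \<le> at_time W T \<omega>}"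
      by auto
    then have "prob {\<omega>\<in>space M. x \<le> at_time W T \<omega>}
      = prob (at_time W T -` {x} \<inter> space M) + prob {\<omega>\<in>space M. x + 1 \<le> at_time W T \<omega>}"
      by (simp only:) (rule finite_measure_Union; auto)
    then show ?thesis unfolding prob_le_at_T using tail_eq_Suc[of \<mu> x] by simp
  qed
  then have "distr M (count_space UNIV) (at_time W T) = measure_pmf \<mu>"
    by (intro measure_eqI_countable[of _ UNIV])
       (auto simp: emeasure_distr emeasure_pmf_single emeasure_eq_measure)
  then show ?thesis using AE_T_finite by (simp add: embeds_def)
qed

lemma uniformly_integrable_if_Nats: "uniformly_integrable M UNIV (\<lambda>n \<omega>. real_of_int (stopped W T n \<omega>))"
proof -
  obtain a where a: "\<Psi> a = 0" "a \<le> 0" using barycenter_vanishes_if_Nats by blast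
  have "AE \<omega> in M. \<forall>n. a \<le> stopped W T n \<omega>"
    using AE_nearest_neighbour_path
  proof eventually_elim
    case (elim \<omega>)
    then interpret nearest_neighbour_path W \<omega> .
    show ?case using a by (auto intro: stopped_ge)
  qed
  then show ?thesis
    by (rule uniformly_integrable_stopped[OF stops_ay_time embeds_moments(1,2,3)[OF embeds_if_Nats]])
qed

end

end

end

theorem proposition4:
  fixes M :: "'a measure" and \<xi> :: "nat \<Rightarrow> 'a \<Rightarrow> int" and \<mu> :: "int pmf"
  assumes "simple_symmetric_steps M \<xi>"
    and "centered \<mu>"
  shows "(embeds M (walk \<xi>) (azema_yor_time \<mu> (walk \<xi>)) \<mu> \<longleftrightarrow>
            (\<forall>x::int. barycenter \<mu> x \<in> \<nat>)) \<and>
         ((\<forall>x::int. barycenter \<mu> x \<in> \<nat>) \<longrightarrow>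
            martingale M (natural_filtration M (walk \<xi>))
              (\<lambda>n \<omega>. real_of_int (stopped (walk \<xi>) (azema_yor_time \<mu> (walk \<xi>)) n \<omega>)) \<and>
            uniformly_integrable M (UNIV :: nat set)
              (\<lambda>n \<omega>. real_of_int (stopped (walk \<xi>) (azema_yor_time \<mu> (walk \<xi>)) n \<omega>)))"
proof -
  interpret simple_symmetric_steps M \<xi> by (rule assms(1))
  note centered = \<open>centered \<mu>\<close>
  show ?thesis
    unfolding azema_yor_time_eq
  proof (intro conjI iffI impI allI)
    show "barycenter \<mu> x \<in> \<nat>" if "embeds M W (ay_time (barycenter \<mu>) W) \<mu>" for x
      using barycenter_Nats_if_embeds[OF centered that] .
  next
    assume Nats: "\<forall>x. barycenter \<mu> x \<in> \<nat>"
    then show "embeds M W (ay_time (barycenter \<mu>) W) \<mu>"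
      by (intro embeds_if_Nats[OF centered]) simp
    show "martingale M \<F> (\<lambda>n \<omega>. real_of_int (stopped W (ay_time (barycenter \<mu>) W) n \<omega>))"
      by (rule martingale_stopped[OF stops_ay_time])
    show "uniformly_integrable M UNIV (\<lambda>n \<omega>. real_of_int (stopped W (ay_time (barycenter \<mu>) W) n \<omega>))"
      using Nats by (intro uniformly_integrable_if_Nats[OF centered]) simp
  qed
qed

end
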